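(* Let $\mathcal{U}$ and $\mathcal{V}$ be infinite dimensional, separable, reflexive Banach spaces over $\mathbb{K}$ ($=\mathbb{R}$ or $\mathbb{C}$) and let $a:\mathcal{U}\times\mathcal{V}\to\mathbb{K}$ be a continuous sesquilinear form such that for every $L\in\mathcal{V}'$ there exists a unique $u\in\mathcal{U}$ with $a(u,v)=\langle L,v\rangle$ for all $v\in\mathcal{V}$. Then the following assertions are equivalent: (i) there exist approximating sequences $(\mathcal{U}_n)_{n\in\mathbb{N}^*}$ of $\mathcal{U}$ and $(\mathcal{V}_n)_{n\in\mathbb{N}^*}$ of $\mathcal{V}$, with $0\ne\dim\mathcal{U}_n=\dim\mathcal{V}_n$ for all $n$, such that the associated Galerkin approximation converges; (ii) the space $\mathcal{U}$ has the bounded projection approximation property; (iii) the space $\mathcal{U}$ has a finite dimensional Schauder decomposition.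
   Context: $\mathbb{N}^*=\{1,2,\dots\}$. A sesquilinear form is linear in the first and antilinear in the second variable (bilinear if $\mathbb{K}=\mathbb{R}$); $\mathcal{V}'$ denotes the space of continuous antilinear functionals on $\mathcal{V}$ (the usual dual if $\mathbb{K}=\mathbb{R}$), and $\langle L,v\rangle$ is the value of $L\in\mathcal{V}'$ at $v$. Continuity of $a$ means there is $M>0$ with $|a(u,v)|\le M\|u\|_{\mathcal{U}}\|v\|_{\mathcal{V}}$ for all $u,v$. Approximating sequence: for a separable Banach space $\mathcal{X}$, a sequence $(\mathcal{X}_n)_{n\in\mathbb{N}^*}$ of finite dimensional subspaces (not assumed nested) such that $\mathrm{dist}(x,\mathcal{X}_n):=\inf\{\|x-\chi\|:\chi\in\mathcal{X}_n\}\to0$ as $n\to\infty$ for all $x\in\mathcal{X}$. For $L\in\mathcal{V}'$ consider (P): find $u\in\mathcal{U}$ with $a(u,v)=\langle L,v\rangle$ for all $v\in\mathcal{V}$; and (P$_n$): find $u_n\in\mathcal{U}_n$ with $a(u_n,\chi)=\langle L,\chi\rangle$ for all $\chi\in\mathcal{V}_n$. "The Galerkin approximation converges" means: (P) and, for every $n\in\mathbb{N}^*$, (P$_n$) have a unique solution for every $L\in\mathcal{V}'$, and there is a constant $\gamma>0$ independent of $n$ and $L$ such that $\|u-u_n\|_{\mathcal{U}}\le\gamma\,\mathrm{dist}(u,\mathcal{U}_n)$ for all $n\in\mathbb{N}^*$ and $L\in\mathcal{V}'$, where $u$ and $u_n$ are the solutions of (P) and (P$_n$). A separable Banach space $\mathcal{X}$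 has the bounded projection approximation property if there is a sequence $(P_n)_{n\in\mathbb{N}^*}$ of bounded finite rank operators on $\mathcal{X}$ with $P_n^2=P_n$ for all $n$ and $\lim_{n\to\infty}P_nx=x$ for all $x\in\mathcal{X}$. It has a finite dimensional (Schauder) decomposition if such a sequence can be found with the additional property $P_mP_n=P_nP_m=P_m$ for all $n\ge m$. *)

theory Defs
  imports "HOL-Analysis.Analysis"
begin

section \<open>The scalar field: the reals or the complex numbers\<close>

text \<open>
  A type of this class is, up to an isometric isomorphism of real algebras, either \<open>real\<close> with
  trivial conjugation or \<open>complex\<close> with complex conjugation. A statement about all types of the
  class is thus a statement about both choices of the scalar field.
\<close>

class real_or_complex = real_normed_field +
  fixes conjg :: "'a \<Rightarrow> 'a"
  assumes real_or_complex:
    "(\<exists>\<phi> :: 'a \<Rightarrow> real. bij \<phi> \<and> \<phi> 1 = 1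
        \<and> (\<forall>x y. \<phi> (x + y) = \<phi> x + \<phi> y \<and> \<phi> (x * y) = \<phi> x * \<phi> y)
        \<and> (\<forall>r x. \<phi> (scaleR r x) = r * \<phi> x)
        \<and> (\<forall>x. norm x = \<bar>\<phi> x\<bar>) \<and> (\<forall>x. \<phi> (conjg x) = \<phi> x))
     \<or> (\<exists>\<phi> :: 'a \<Rightarrow> complex. bij \<phi> \<and> \<phi> 1 = 1
        \<and> (\<forall>x y. \<phi> (x + y) = \<phi> x + \<phi> y \<and> \<phi> (x * y) = \<phi> x * \<phi> y)
        \<and> (\<forall>r x. \<phi> (scaleR r x) = complex_of_real r * \<phi> x)
        \<and> (\<forall>x. norm x = cmod (\<phi> x)) \<and> (\<forall>x. \<phi> (conjg x) = cnj (\<phi> x)))"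

instantiation real :: real_or_complex
begin
definition conjg_real :: "real \<Rightarrow> real" where "conjg_real x = x"
instance
  by standard (rule disjI1, rule exI[of _ "\<lambda>x. x"], simp add: conjg_real_def bij_id[unfolded id_def])
end

instantiation complex :: real_or_complex
begin
definition conjg_complex :: "complex \<Rightarrow> complex" where "conjg_complex z = cnj z"
instance
  by standard (rule disjI2, rule exI[of _ "\<lambda>x. x"],
      simp add: conjg_complex_def bij_id[unfolded id_def] scaleR_conv_of_real)
end


section \<open>Banach spaces over the scalar field\<close>

text \<open>
  The class \<open>banach\<close> only provides a real Banach space; the parameter \<open>s\<close> is the multiplication by
  scalars in the field \<open>'k\<close>, for which the norm is homogeneous.
\<close>

locale banach_over = vector_space s
  for s :: "'k::real_or_complex \<Rightarrow> 'x::banach \<Rightarrow> 'x" +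
  assumes scale_of_real: "s (of_real r) x = scaleR r x"
    and norm_scale: "norm (s c x) = norm c * norm x"

lemma banach_over_scaleR: "banach_over (scaleR :: real \<Rightarrow> 'x::banach \<Rightarrow> 'x)"
  by unfold_locales (simp_all add: algebra_simps)

definition fin_dim_subspace :: "('k::real_or_complex \<Rightarrow> 'x::banach \<Rightarrow> 'x) \<Rightarrow> 'x set \<Rightarrow> bool" where
  "fin_dim_subspace s S \<longleftrightarrow> (\<exists>B. finite B \<and> S = module.span s B)"

definition dual :: "('k::real_or_complex \<Rightarrow> 'x::banach \<Rightarrow> 'x) \<Rightarrow> ('x \<Rightarrow> 'k) set" where
  "dual s = {f. Vector_Spaces.linear s (*) f \<and> continuous_on UNIV f}"

definition antilinear :: "('k::real_or_complex \<Rightarrow> 'x::banach \<Rightarrow> 'x) \<Rightarrow> ('x \<Rightarrow> 'k) \<Rightarrow> bool" where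
  "antilinear s f \<longleftrightarrow> (\<forall>x y. f (x + y) = f x + f y) \<and> (\<forall>c x. f (s c x) = conjg c * f x)"

definition antidual :: "('k::real_or_complex \<Rightarrow> 'x::banach \<Rightarrow> 'x) \<Rightarrow> ('x \<Rightarrow> 'k) set" where
  "antidual s = {f. antilinear s f \<and> continuous_on UNIV f}"

text \<open>
  The dual space is a set of functions, not a type, so that continuity of an element \<open>\<Phi>\<close> of the
  bidual is expressed as boundedness with respect to the operator norm on that set.
\<close>

definition bidual ::
    "('k::real_or_complex \<Rightarrow> 'x::banach \<Rightarrow> 'x) \<Rightarrow> (('x \<Rightarrow> 'k) \<Rightarrow> 'k) set" where
  "bidual s = {\<Phi>.
     (\<forall>f\<in>dual s. \<forall>g\<in>dual s. \<Phi> (\<lambda>x. f x + g x) = \<Phi> f + \<Phi> g) \<and>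
     (\<forall>c. \<forall>f\<in>dual s. \<Phi> (\<lambda>x. c * f x) = c * \<Phi> f) \<and>
     (\<exists>C. \<forall>f\<in>dual s. norm (\<Phi> f) \<le> C * onorm f)}"

definition reflexive_space :: "('k::real_or_complex \<Rightarrow> 'x::banach \<Rightarrow> 'x) \<Rightarrow> bool" where
  "reflexive_space s \<longleftrightarrow> (\<forall>\<Phi>\<in>bidual s. \<exists>x. \<forall>f\<in>dual s. \<Phi> f = f x)"


section \<open>Sesquilinear forms and Galerkin approximation\<close>

text \<open>All sequences below are indexed by the positive integers; the value at \<open>0\<close> is irrelevant.\<close>

definition sesquilinear ::
    "('k::real_or_complex \<Rightarrow> 'u::banach \<Rightarrow> 'u) \<Rightarrow> ('k \<Rightarrow> 'v::banach \<Rightarrow> 'v)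
      \<Rightarrow> ('u \<Rightarrow> 'v \<Rightarrow> 'k) \<Rightarrow> bool" where
  "sesquilinear sU sV a \<longleftrightarrow>
     (\<forall>v. Vector_Spaces.linear sU (*) (\<lambda>u. a u v)) \<and> (\<forall>u. antilinear sV (a u))"

definition continuous_form ::
    "('u::real_normed_vector \<Rightarrow> 'v::real_normed_vector \<Rightarrow> 'k::real_normed_field) \<Rightarrow> bool" where
  "continuous_form a \<longleftrightarrow> (\<exists>M>0. \<forall>u v. norm (a u v) \<le> M * norm u * norm v)"

definition approximating_sequence ::
    "('k::real_or_complex \<Rightarrow> 'x::banach \<Rightarrow> 'x) \<Rightarrow> (nat \<Rightarrow> 'x set) \<Rightarrow> bool" where
  "approximating_sequence s X \<longleftrightarrow>
     (\<forall>n\<ge>1. fin_dim_subspace s (X n)) \<and> (\<forall>x. (\<lambda>n. infdist x (X n)) \<longlonglongrightarrow> 0)"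

definition is_solution ::
    "('u \<Rightarrow> 'v \<Rightarrow> 'k) \<Rightarrow> ('v \<Rightarrow> 'k) \<Rightarrow> 'u set \<Rightarrow> 'v set \<Rightarrow> 'u \<Rightarrow> bool" where
  "is_solution a L X Y u \<longleftrightarrow> u \<in> X \<and> (\<forall>v\<in>Y. a u v = L v)"

definition galerkin_converges ::
    "('k::real_or_complex \<Rightarrow> 'v::banach \<Rightarrow> 'v) \<Rightarrow> ('u::banach \<Rightarrow> 'v \<Rightarrow> 'k)
      \<Rightarrow> (nat \<Rightarrow> 'u set) \<Rightarrow> (nat \<Rightarrow> 'v set) \<Rightarrow> bool" where
  "galerkin_converges sV a U V \<longleftrightarrow>
     (\<forall>L\<in>antidual sV. \<exists>!u. is_solution a L UNIV UNIV u) \<and>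
     (\<forall>n\<ge>1. \<forall>L\<in>antidual sV. \<exists>!w. is_solution a L (U n) (V n) w) \<and>
     (\<exists>\<gamma>>0. \<forall>n\<ge>1. \<forall>L\<in>antidual sV. \<forall>u w.
        is_solution a L UNIV UNIV u \<longrightarrow> is_solution a L (U n) (V n) w \<longrightarrow>
        norm (u - w) \<le> \<gamma> * infdist u (U n))"


section \<open>Approximation properties\<close>

definition bounded_finite_rank ::
    "('k::real_or_complex \<Rightarrow> 'x::banach \<Rightarrow> 'x) \<Rightarrow> ('x \<Rightarrow> 'x) \<Rightarrow> bool" where
  "bounded_finite_rank s P \<longleftrightarrow>
     Vector_Spaces.linear s s P \<and> bounded_linear P \<and> fin_dim_subspace s (range P)"

definition approximating_projections ::
    "('k::real_or_complex \<Rightarrow> 'x::banach \<Rightarrow> 'x) \<Rightarrow> (nat \<Rightarrow> 'x \<Rightarrow> 'x) \<Rightarrow> bool" where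
  "approximating_projections s P \<longleftrightarrow>
     (\<forall>n\<ge>1. bounded_finite_rank s (P n) \<and> P n \<circ> P n = P n) \<and>
     (\<forall>x. (\<lambda>n. P n x) \<longlonglongrightarrow> x)"

definition bounded_projection_approximation_property ::
    "('k::real_or_complex \<Rightarrow> 'x::banach \<Rightarrow> 'x) \<Rightarrow> bool" where
  "bounded_projection_approximation_property s \<longleftrightarrow> (\<exists>P. approximating_projections s P)"

definition finite_dimensional_decomposition ::
    "('k::real_or_complex \<Rightarrow> 'x::banach \<Rightarrow> 'x) \<Rightarrow> bool" where
  "finite_dimensional_decomposition s \<longleftrightarrow>
     (\<exists>P. approximating_projections s P \<and>
        (\<forall>m\<ge>1. \<forall>n\<ge>m. P m \<circ> P n = P m \<and> P n \<circ> P m = P m))"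

end

theory Submission
  imports Defs
begin

text \<open>
  All three properties speak about projections. If the Galerkin approximation converges, the map
  that sends \<open>u\<close> to its Galerkin solution \<open>u\<^sub>n\<close> is a projection onto \<open>U\<^sub>n\<close>, and the quasi-optimal error
  bound says both that these projections are bounded and that they converge to the identity.

  In the opposite direction let \<open>(P\<^sub>n)\<close> be a finite dimensional decomposition of \<open>U\<close>. The form identifies
  \<open>V\<close> with the dual of \<open>U\<close> (\<open>dual_eq_form\<close>): the functionals \<open>a(\<cdot>,v)\<close> are dense in the dual because
  \<open>U\<close> is reflexive, and they form a closed subspace by the inf-sup inequality, a consequence of uniform
  boundedness. Hence each \<open>P\<^sub>n\<close> has an adjoint \<open>Q\<^sub>n\<close> with \<open>a(P\<^sub>n u, v) = a(u, Q\<^sub>n v)\<close>, and for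
  \<open>U\<^sub>n = range P\<^sub>n\<close>, \<open>V\<^sub>n = range Q\<^sub>n\<close> the Galerkin solution is \<open>P\<^sub>n u\<close>, whose error is at most
  \<open>(1 + sup \<parallel>P\<^sub>n\<parallel>) dist(u, U\<^sub>n)\<close>. A priori \<open>Q\<^sub>n v\<close> converges to \<open>v\<close> only weakly. But the \<open>V\<^sub>n\<close>
  increase, so their union is a weakly dense subspace, which is norm dense by Hahn-Banach, and the
  distances to increasing subspaces with dense union tend to zero. This is the point at which nested
  projections are required, and why the decomposition has to be found first.

  So the heart of the matter is to pass from approximating projections \<open>P\<^sub>n\<close> to nested ones
  (\<open>finite_dimensional_decomposition_if_reflexive\<close>). By induction along a dense sequence it is enough
  to enlarge a given finite rank projection \<open>Q\<close>: to find, with a norm bound that does not depend on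
  \<open>Q\<close>, a finite rank projection \<open>W\<close> with \<open>Q W = W Q = Q\<close> that fixes a given vector
  (\<open>extend_projection\<close>). Suppose that \<open>T\<close> is a finite rank operator with \<open>Q T = Q\<close> and that \<open>P'\<close> is a
  finite rank projection which is the identity on the ranges of \<open>T\<close> and \<open>Q\<close> and on the given vector.
  Then \<open>W = P' + T - T P'\<close>, that is \<open>1 - W = (1 - T) (1 - P')\<close>, does it: \<open>P' T = T\<close> makes \<open>1 - W\<close>
  idempotent. The operator \<open>T\<close> comes from reflexivity. The operators \<open>Q P\<^sub>n\<close> converge weakly to \<open>Q\<close>, so
  some convex combination \<open>T\<^sub>0\<close> of the \<open>P\<^sub>n\<close> satisfies \<open>\<parallel>Q T\<^sub>0 - Q\<parallel> \<le> 1\<close>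
  (\<open>convex_combination_approximates_from_left\<close>), and \<open>T = T\<^sub>0 + (Q - Q T\<^sub>0)\<close> satisfies \<open>Q T = Q\<close>
  exactly. The projection \<open>P'\<close> is some \<open>P\<^sub>n\<close> conjugated by an operator close to the identity
  (\<open>projection_containing_finite_dim\<close>).
\<close>

section \<open>The scalar field\<close>

text \<open>
  The real part, as the polarisation identity expresses it through the norm. This form needs no case
  distinction between the two fields.
\<close>

definition re :: "'k::real_or_complex \<Rightarrow> real" where
  "re c = ((norm (c + 1))\<^sup>2 - (norm c)\<^sup>2 - 1) / 2"

lemma scalar_cases:
  obtains (real) \<phi> :: "'k::real_or_complex \<Rightarrow> real" where "bij \<phi>" "\<phi> 1 = 1" "\<And>x y. \<phi> (x + y) = \<phi> x + \<phi> y"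
      "\<And>x y. \<phi> (x * y) = \<phi> x * \<phi> y" "\<And>r x. \<phi> (r *\<^sub>R x) = r * \<phi> x"
      "\<And>x. norm x = \<bar>\<phi> x\<bar>" "\<And>x. \<phi> (conjg x) = \<phi> x" "\<And>x. re x = \<phi> x"
  | (complex) \<phi> :: "'k::real_or_complex \<Rightarrow> complex" where "bij \<phi>" "\<phi> 1 = 1" "\<And>x y. \<phi> (x + y) = \<phi> x + \<phi> y"
      "\<And>x y. \<phi> (x * y) = \<phi> x * \<phi> y" "\<And>r x. \<phi> (r *\<^sub>R x) = complex_of_real r * \<phi> x"
      "\<And>x. norm x = cmod (\<phi> x)" "\<And>x. \<phi> (conjg x) = cnj (\<phi> x)" "\<And>x. re x = Re (\<phi> x)"
proof -
  have r: "re x = \<phi> x" if "\<phi> 1 = 1" "\<And>x y. \<phi> (x + y) = \<phi> x + \<phi> y" "\<And>x. norm x = \<bar>\<phi> x\<bar>"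
    for \<phi> :: "'k \<Rightarrow> real" and x
    by (simp add: re_def that power2_eq_square algebra_simps)
  have c: "re x = Re (\<phi> x)" if "\<phi> 1 = 1" "\<And>x y. \<phi> (x + y) = \<phi> x + \<phi> y" "\<And>x. norm x = cmod (\<phi> x)"
    for \<phi> :: "'k \<Rightarrow> complex" and x
    unfolding re_def that cmod_power2 by (simp add: that power2_eq_square algebra_simps)
  show thesis
    using real_or_complex[where 'a='k]
  proof (elim disjE exE conjE)
    fix \<phi> :: "'k \<Rightarrow> real"
    assume "bij \<phi>" "\<phi> 1 = 1" "\<forall>x y. \<phi> (x + y) = \<phi> x + \<phi> y \<and> \<phi> (x * y) = \<phi> x * \<phi> y"
      "\<forall>r x. \<phi> (r *\<^sub>R x) = r * \<phi> x" "\<forall>x. norm x = \<bar>\<phi> x\<bar>" "\<forall>x. \<phi> (conjg x) = \<phi> x"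
    then show thesis using r by (intro real) auto
  next
    fix \<phi> :: "'k \<Rightarrow> complex"
    assume "bij \<phi>" "\<phi> 1 = 1" "\<forall>x y. \<phi> (x + y) = \<phi> x + \<phi> y \<and> \<phi> (x * y) = \<phi> x * \<phi> y"
      "\<forall>r x. \<phi> (r *\<^sub>R x) = complex_of_real r * \<phi> x" "\<forall>x. norm x = cmod (\<phi> x)"
      "\<forall>x. \<phi> (conjg x) = cnj (\<phi> x)"
    then show thesis using c by (intro complex) auto
  qed
qed

lemma re_add: "re (x + y) = re x + re (y :: 'k::real_or_complex)"
  by (cases rule: scalar_cases[where 'k='k]) simp_all

lemma re_scaleR: "re (r *\<^sub>R x) = r * re (x :: 'k::real_or_complex)"
  by (cases rule: scalar_cases[where 'k='k]) simp_all

lemma abs_re_le: "\<bar>re x\<bar> \<le> norm (x :: 'k::real_or_complex)"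
  by (cases rule: scalar_cases[where 'k='k]) (simp_all add: abs_Re_le_cmod)

lemma bounded_linear_re: "bounded_linear (re :: 'k::real_or_complex \<Rightarrow> real)"
  by (rule bounded_linear_intro[where K=1]) (simp_all add: re_add re_scaleR abs_re_le)

lemma re_conjg: "re (conjg x) = re (x :: 'k::real_or_complex)"
  by (cases rule: scalar_cases[where 'k='k]) simp_all

lemma re_conjg_mult_self: "re (conjg x * x) = (norm (x :: 'k::real_or_complex))\<^sup>2"
  by (cases rule: scalar_cases[where 'k='k]) (simp_all add: cmod_power2 flip: power2_eq_square)

lemma conjg_add: "conjg (x + y) = conjg x + conjg (y :: 'k::real_or_complex)"
proof (cases rule: scalar_cases[where 'k='k])
  case (real \<phi>)
  show ?thesis by (rule bij_is_inj[OF real(1), THEN injD]) (simp add: real)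
next
  case (complex \<phi>)
  show ?thesis by (rule bij_is_inj[OF complex(1), THEN injD]) (simp add: complex)
qed

lemma conjg_mult: "conjg (x * y) = conjg x * conjg (y :: 'k::real_or_complex)"
proof (cases rule: scalar_cases[where 'k='k])
  case (real \<phi>)
  show ?thesis by (rule bij_is_inj[OF real(1), THEN injD]) (simp add: real)
next
  case (complex \<phi>)
  show ?thesis by (rule bij_is_inj[OF complex(1), THEN injD]) (simp add: complex)
qed

lemma conjg_conjg: "conjg (conjg x) = (x :: 'k::real_or_complex)"
proof (cases rule: scalar_cases[where 'k='k])
  case (real \<phi>)
  show ?thesis by (rule bij_is_inj[OF real(1), THEN injD]) (simp add: real)
next
  case (complex \<phi>)
  show ?thesis by (rule bij_is_inj[OF complex(1), THEN injD]) (simp add: complex)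
qed

lemma conjg_scaleR: "conjg (r *\<^sub>R x) = r *\<^sub>R conjg (x :: 'k::real_or_complex)"
proof (cases rule: scalar_cases[where 'k='k])
  case (real \<phi>)
  show ?thesis by (rule bij_is_inj[OF real(1), THEN injD]) (simp add: real)
next
  case (complex \<phi>)
  show ?thesis by (rule bij_is_inj[OF complex(1), THEN injD]) (simp add: complex)
qed

lemma norm_conjg: "norm (conjg x) = norm (x :: 'k::real_or_complex)"
  by (cases rule: scalar_cases[where 'k='k]) simp_all

lemma bounded_linear_conjg: "bounded_linear (conjg :: 'k::real_or_complex \<Rightarrow> 'k)"
  by (rule bounded_linear_intro[where K=1]) (simp_all add: conjg_add conjg_scaleR norm_conjg)

lemma conjg_of_real: "conjg (of_real r) = (of_real r :: 'k::real_or_complex)"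
proof -
  have 1: "conjg 1 = (1 :: 'k)"
    by (metis conjg_conjg conjg_mult mult.left_neutral mult.right_neutral)
  show ?thesis by (simp add: of_real_def conjg_scaleR 1)
qed

lemma re_mult_ext:
  fixes x y :: "'k::real_or_complex"
  assumes "\<And>c. re (c * x) = re (c * y)"
  shows "x = y"
proof -
  interpret re: bounded_linear "re :: 'k \<Rightarrow> real" by (rule bounded_linear_re)
  have "re (conjg (x - y) * (x - y)) = 0"
    using assms[of "conjg (x - y)"] by (simp add: right_diff_distrib re.diff)
  then show ?thesis by (simp add: re_conjg_mult_self)
qed

text \<open>
  The pairing \<open>re (c * k)\<close> identifies the field with its real dual. Applied along the scalar multiples
  of a vector, it turns a real-linear functional into a scalar-linear one with that real part; since
  \<open>k\<close> is unique by \<open>re_mult_ext\<close>, linearity over the field comes for free.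
\<close>

lemma real_functional_eq_re_mult:
  fixes \<psi> :: "'k::real_or_complex \<Rightarrow> real"
  assumes "linear \<psi>"
  shows "\<exists>k. \<forall>c. \<psi> c = re (c * k)"
proof (cases rule: scalar_cases[where 'k='k])
  case (real \<phi>)
  have "c = \<phi> c *\<^sub>R 1" for c
    by (rule bij_is_inj[OF real(1), THEN injD]) (simp add: real)
  then have "\<psi> c = \<phi> c * \<psi> 1" for c
    by (metis assms linear_cmul real_scaleR_def)
  moreover obtain k where "\<phi> k = \<psi> 1" using real(1) by (metis bij_pointE)
  ultimately show ?thesis using real by (metis)
next
  case (complex \<phi>)
  interpret linear \<psi> by fact
  obtain j where j: "\<phi> j = \<i>" using complex(1) by (metis bij_pointE)
  obtain k where k: "\<phi> k = Complex (\<psi> 1) (- \<psi> j)" using complex(1) by (metis bij_pointE)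
  have "\<psi> c = re (c * k)" for c
  proof -
    have "c = Re (\<phi> c) *\<^sub>R 1 + Im (\<phi> c) *\<^sub>R j"
      by (rule bij_is_inj[OF complex(1), THEN injD]) (simp add: complex j complex_eq mult.commute)
    then have "\<psi> c = Re (\<phi> c) * \<psi> 1 + Im (\<phi> c) * \<psi> j"
      by (metis add scaleR real_scaleR_def)
    then show ?thesis by (simp add: complex k)
  qed
  then show ?thesis by blast
qed

section \<open>The Hahn-Banach theorem and separation of convex sets\<close>

definition sublinear :: "('a::real_vector \<Rightarrow> real) \<Rightarrow> bool" where
  "sublinear p \<longleftrightarrow> (\<forall>x y. p (x + y) \<le> p x + p y) \<and> (\<forall>t\<ge>0. \<forall>x. p (t *\<^sub>R x) = t * p x)"

lemma sublinear_add: "sublinear p \<Longrightarrow> p (x + y) \<le> p x + p y"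
  and sublinear_scaleR: "sublinear p \<Longrightarrow> 0 \<le> t \<Longrightarrow> p (t *\<^sub>R x) = t * p x"
  by (auto simp: sublinear_def)

lemma sublinear_zero: "sublinear p \<Longrightarrow> p 0 = 0"
  using sublinear_scaleR[of p 0 0] by simp

lemma sublinear_minus: "sublinear p \<Longrightarrow> - p (- x) \<le> p x"
  using sublinear_add[of p x "- x"] sublinear_zero[of p] by simp

text \<open>
  The relation \<open>G x r\<close> says that \<open>r\<close> is an admissible upper bound for the value at \<open>x\<close>: it is a convex
  cone, and the infimum is its lower boundary. The three sublinear functionals that are needed below
  (the lower bound of a chain, the directional improvement of a functional, and the functional that
  separates a point from a convex set) all arise in this way.
\<close>

lemma sublinear_Inf:
  fixes G :: "'a::real_vector \<Rightarrow> real \<Rightarrow> bool"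
  assumes add: "\<And>x r y s. G x r \<Longrightarrow> G y s \<Longrightarrow> G (x + y) (r + s)"
    and scale: "\<And>t x r. t > 0 \<Longrightarrow> G x r \<Longrightarrow> G (t *\<^sub>R x) (t * r)"
    and nonempty: "\<And>x. \<exists>r. G x r"
    and below: "\<And>x r. G x r \<Longrightarrow> b x \<le> r"
    and zero: "G 0 0" "\<And>r. G 0 r \<Longrightarrow> 0 \<le> r"
  shows "sublinear (\<lambda>x. Inf {r. G x r})"
proof -
  define p where "p x = Inf {r. G x r}" for x
  have lower: "p x \<le> r" if "G x r" for x r
    unfolding p_def using that below by (intro cInf_lower bdd_belowI[of _ "b x"]) auto
  have greatest: "s \<le> p x" if "\<And>r. G x r \<Longrightarrow> s \<le> r" for x s
    unfolding p_def using nonempty[of x] that by (intro cInf_greatest) auto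
  have sub: "p (x + y) \<le> p x + p y" for x y
  proof -
    have "p (x + y) - r \<le> p y" if "G x r" for r
      by (rule greatest) (use add[OF that] lower in \<open>fastforce simp: algebra_simps\<close>)
    then have "p (x + y) - p y \<le> p x"
      by (intro greatest) (simp add: algebra_simps)
    then show ?thesis by simp
  qed
  have le: "p (t *\<^sub>R x) \<le> t * p x" if "t > 0" for t x
  proof -
    have "p (t *\<^sub>R x) / t \<le> p x"
    proof (rule greatest)
      fix r assume "G x r"
      then have "p (t *\<^sub>R x) \<le> t * r" using scale that lower by blast
      then show "p (t *\<^sub>R x) / t \<le> r" using that by (simp add: field_simps)
    qed
    then show ?thesis using that by (simp add: field_simps)
  qed
  have hom: "p (t *\<^sub>R x) = t * p x" if "t \<ge> 0" for t x
  proof (cases "t = 0")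
    case True
    have "p 0 = 0" using lower[OF zero(1)] greatest[of 0 0] zero(2) by force
    then show ?thesis using True by simp
  next
    case False
    then have t: "t > 0" using that by simp
    have "p x \<le> inverse t * p (t *\<^sub>R x)" using le[of "inverse t" "t *\<^sub>R x"] t by simp
    then have "t * p x \<le> p (t *\<^sub>R x)" using t by (simp add: field_simps)
    then show ?thesis using le[OF t] by (simp add: antisym)
  qed
  show ?thesis using sub hom unfolding sublinear_def p_def by blast
qed

text \<open>
  For every direction \<open>y\<close> the functional \<open>inf {q (z + t y) - t q y | t \<ge> 0}\<close> is sublinear and below
  \<open>q\<close>, so by minimality it is \<open>q\<close>. The choice \<open>t = 1\<close> then gives \<open>q x + q y \<le> q (x + y)\<close>.
\<close>

lemma minimal_sublinear_is_linear:
  fixes q :: "'a::real_vector \<Rightarrow> real"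
  assumes q: "sublinear q"
    and minimal: "\<And>q'. sublinear q' \<Longrightarrow> (\<And>x. q' x \<le> q x) \<Longrightarrow> q' = q"
  shows "linear q"
proof -
  have add_ge: "q x + q y \<le> q (x + y)" for x y
  proof -
    define G where "G z r \<longleftrightarrow> (\<exists>t\<ge>0. q (z + t *\<^sub>R y) - t * q y \<le> r)" for z r
    have lb: "- q (- z) \<le> r" if "G z r" for z r
    proof -
      from that obtain t where t: "t \<ge> 0" "q (z + t *\<^sub>R y) - t * q y \<le> r" by (auto simp: G_def)
      have "t * q y \<le> q (- z) + q (z + t *\<^sub>R y)"
        using sublinear_add[OF q, of "- z" "z + t *\<^sub>R y"] sublinear_scaleR[OF q t(1), of y] by simp
      then show ?thesis using t by simp
    qed
    have G_q: "G z (q z)" for z unfolding G_def by (rule exI[of _ 0]) simp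
    have "sublinear (\<lambda>z. Inf {r. G z r})"
    proof (rule sublinear_Inf[where b="\<lambda>z. - q (- z)"])
      fix z r z' r' assume "G z r" "G z' r'"
      then obtain t t' where "t \<ge> 0" "q (z + t *\<^sub>R y) - t * q y \<le> r"
        "t' \<ge> 0" "q (z' + t' *\<^sub>R y) - t' * q y \<le> r'" by (auto simp: G_def)
      then show "G (z + z') (r + r')"
        using sublinear_add[OF q, of "z + t *\<^sub>R y" "z' + t' *\<^sub>R y"] unfolding G_def
        by (intro exI[of _ "t + t'"]) (simp add: algebra_simps)
    next
      fix s :: real and z r assume s: "s > 0" and "G z r"
      then obtain t where t: "t \<ge> 0" "q (z + t *\<^sub>R y) - t * q y \<le> r" by (auto simp: G_def)
      have "q (s *\<^sub>R z + (s * t) *\<^sub>R y) - (s * t) * q y = s * (q (z + t *\<^sub>R y) - t * q y)"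
        using sublinear_scaleR[OF q, of s "z + t *\<^sub>R y"] s by (simp add: algebra_simps)
      also have "\<dots> \<le> s * r" using t s by simp
      finally show "G (s *\<^sub>R z) (s * r)" using t s unfolding G_def by (intro exI[of _ "s * t"]) simp
    next
      show "\<exists>r. G z r" for z using G_q by blast
      show "G 0 0" using G_q[of 0] sublinear_zero[OF q] by simp
      show "0 \<le> r" if "G 0 r" for r using lb[OF that] sublinear_zero[OF q] by simp
    qed (rule lb)
    moreover have lower: "Inf {r. G z r} \<le> r" if "G z r" for z r
      using that lb by (intro cInf_lower bdd_belowI[of _ "- q (- z)"]) auto
    ultimately have "(\<lambda>z. Inf {r. G z r}) = q" using G_q by (intro minimal) auto
    then have "q x \<le> r" if "G x r" for r using lower[OF that] by metis
    moreover have "G x (q (x + y) - q y)" unfolding G_def by (rule exI[of _ 1]) simp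
    ultimately show ?thesis by fastforce
  qed
  have add: "q (x + y) = q x + q y" for x y
    using add_ge[of x y] sublinear_add[OF q, of x y] by simp
  have minus: "q (- x) = - q x" for x
    using add[of x "- x"] sublinear_zero[OF q] by simp
  show ?thesis
  proof (rule linearI)
    fix c x
    show "q (c *\<^sub>R x) = c *\<^sub>R q x"
    proof (cases "c \<ge> 0")
      case False
      then show ?thesis using sublinear_scaleR[OF q, of "- c" x] minus[of "c *\<^sub>R x"] by simp
    qed (simp add: sublinear_scaleR[OF q])
  qed (rule add)
qed

text \<open>
  Below every sublinear functional there is a minimal one by Zorn's lemma, since a chain has its
  pointwise infimum as lower bound; the infimum is finite because \<open>- p (- x) \<le> q x\<close> whenever \<open>q \<le> p\<close>.
\<close>

theorem Hahn_Banach: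
  fixes p :: "'a::real_vector \<Rightarrow> real"
  assumes p: "sublinear p"
  shows "\<exists>f. linear f \<and> (\<forall>x. f x \<le> p x)"
proof -
  define A where "A = {q. sublinear q \<and> (\<forall>x. q x \<le> p x)}"
  define P where "P f g \<longleftrightarrow> (\<forall>x. g x \<le> f x)" for f g :: "'a \<Rightarrow> real"
  have A_lb: "- p (- x) \<le> q x" if "q \<in> A" for q x
    using that sublinear_minus[of q x] by (auto simp: A_def dest: spec[of _ "- x"])
  have "\<exists>m\<in>A. \<forall>q\<in>A. P m q \<longrightarrow> q = m"
  proof (rule predicate_Zorn)
    show "partial_order_on A (relation_of P A)"
      by (rule partial_order_on_relation_ofI) (auto simp: P_def fun_eq_iff intro: order_trans antisym)
  next
    fix C assume C: "C \<in> Chains (relation_of P A)"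
    then have cmp: "P q q' \<or> P q' q" if "q \<in> C" "q' \<in> C" for q q'
      using that by (auto simp: Chains_def relation_of_def)
    have CA: "C \<subseteq> A" using C by (auto simp: Chains_def relation_of_def)
    show "\<exists>u\<in>A. \<forall>q\<in>C. P q u"
    proof (cases "C = {}")
      case True
      then show ?thesis using p by (auto simp: A_def)
    next
      case False
      define G where "G x r \<longleftrightarrow> (\<exists>q\<in>C. q x \<le> r)" for x r
      have lb: "- p (- x) \<le> r" if Gxr: "G x r" for x r
      proof -
        obtain q where "q \<in> C" "q x \<le> r" using Gxr by (auto simp: G_def)
        then show ?thesis using A_lb[of q x] CA by auto
      qed
      have sub: "sublinear q" if "q \<in> C" for q using that CA by (auto simp: A_def)
      have lower: "Inf {r. G x r} \<le> r" if "G x r" for x r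
        using that lb by (intro cInf_lower bdd_belowI[of _ "- p (- x)"]) auto
      have "sublinear (\<lambda>x. Inf {r. G x r})"
      proof (rule sublinear_Inf[where b="\<lambda>x. - p (- x)"])
        fix x r y s assume "G x r" "G y s"
        then obtain q q' where q: "q \<in> C" "q' \<in> C" "q x \<le> r" "q' y \<le> s" by (auto simp: G_def)
        then have "\<exists>u\<in>C. u x \<le> r \<and> u y \<le> s" using cmp[OF q(1,2)] unfolding P_def
          by (meson order_trans)
        then show "G (x + y) (r + s)"
          unfolding G_def using sublinear_add[OF sub] by (meson add_mono order_trans)
      next
        fix t :: real and x r assume t: "t > 0" and "G x r"
        then obtain q where "q \<in> C" "q x \<le> r" by (auto simp: G_def)
        then show "G (t *\<^sub>R x) (t * r)"
          unfolding G_def using sublinear_scaleR[OF sub, of q t x] t by (intro bexI[of _ q]) auto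
      next
        show "\<exists>r. G x r" for x using False by (auto simp: G_def)
        show "G 0 0" using False sublinear_zero[OF sub] by (fastforce simp: G_def)
        show "0 \<le> r" if "G 0 r" for r using that sublinear_zero[OF sub] by (fastforce simp: G_def)
      qed (rule lb)
      moreover have "Inf {r. G x r} \<le> q x" if "q \<in> C" for q x
        using that by (intro lower) (auto simp: G_def)
      moreover from this False have "Inf {r. G x r} \<le> p x" for x
        using CA by (force simp: A_def intro: order_trans)
      ultimately show ?thesis unfolding A_def P_def
        by (intro bexI[of _ "\<lambda>x. Inf {r. G x r}"]) auto
    qed
  qed
  then obtain m where m: "m \<in> A" "\<And>q. q \<in> A \<Longrightarrow> P m q \<Longrightarrow> q = m" by blast
  have "linear m"
    using m by (intro minimal_sublinear_is_linear) (auto simp: A_def P_def intro: order_trans)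
  then show ?thesis using m by (auto simp: A_def)
qed

text \<open>
  Apply Hahn-Banach to \<open>inf {\<parallel>x + t (c - x0)\<parallel> - t d | t \<ge> 0, c \<in> C}\<close>. Convexity of \<open>C\<close> makes it
  sublinear, and the distance assumption bounds it below by \<open>- \<parallel>x\<parallel>\<close>. It is at most \<open>\<parallel>x\<parallel>\<close>
  (\<open>t = 0\<close>) and at most \<open>- d\<close> at \<open>x0 - c\<close> (\<open>t = 1\<close>).
\<close>

theorem convex_separation:
  fixes C :: "'a::real_normed_vector set"
  assumes "convex C" "C \<noteq> {}" and far: "\<And>c. c \<in> C \<Longrightarrow> d \<le> norm (c - x0)" and "0 \<le> d"
  shows "\<exists>f. bounded_linear f \<and> (\<forall>x. \<bar>f x\<bar> \<le> norm x) \<and> (\<forall>c\<in>C. f x0 + d \<le> f c)"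
proof -
  define G where "G x r \<longleftrightarrow> (\<exists>t\<ge>0. \<exists>c\<in>C. norm (x + t *\<^sub>R (c - x0)) - t * d \<le> r)" for x r
  obtain c0 where c0: "c0 \<in> C" using assms by blast
  have G_norm: "G x (norm x)" for x
    unfolding G_def by (rule exI[of _ 0]) (use c0 in auto)
  have lb: "- norm x \<le> r" if "G x r" for x r
  proof -
    from that obtain t c where tc: "t \<ge> 0" "c \<in> C" "norm (x + t *\<^sub>R (c - x0)) - t * d \<le> r"
      by (auto simp: G_def)
    have "norm (t *\<^sub>R (c - x0)) \<le> norm (x + t *\<^sub>R (c - x0)) + norm x"
      using norm_triangle_ineq4[of "x + t *\<^sub>R (c - x0)" x] by simp
    moreover have "t * d \<le> norm (t *\<^sub>R (c - x0))" using far[OF tc(2)] tc(1) by (simp add: mult_left_mono)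
    ultimately show ?thesis using tc by simp
  qed
  have "sublinear (\<lambda>x. Inf {r. G x r})"
  proof (rule sublinear_Inf[where b="\<lambda>x. - norm x"])
    fix x r y s assume "G x r" "G y s"
    then obtain t c t' c' where *: "t \<ge> 0" "c \<in> C" "norm (x + t *\<^sub>R (c - x0)) - t * d \<le> r"
      "t' \<ge> 0" "c' \<in> C" "norm (y + t' *\<^sub>R (c' - x0)) - t' * d \<le> s" by (auto simp: G_def)
    have "\<exists>c''\<in>C. t *\<^sub>R c + t' *\<^sub>R c' = (t + t') *\<^sub>R c''"
    proof (cases "t + t' = 0")
      case True
      then have "t = 0" "t' = 0" using * by auto
      then show ?thesis using * by auto
    next
      case False
      then have "t + t' > 0" using * by simp
      then show ?thesis using convexD[OF assms(1) *(2,5), of "t / (t + t')" "t' / (t + t')"] *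
        by (intro bexI[of _ "(t / (t + t')) *\<^sub>R c + (t' / (t + t')) *\<^sub>R c'"])
          (auto simp: scaleR_add_right add_divide_distrib[symmetric])
    qed
    then obtain c'' where c'': "c'' \<in> C" "t *\<^sub>R c + t' *\<^sub>R c' = (t + t') *\<^sub>R c''" by blast
    have "(x + t *\<^sub>R (c - x0)) + (y + t' *\<^sub>R (c' - x0)) = (x + y) + (t + t') *\<^sub>R (c'' - x0)"
      using c''(2) by (simp add: algebra_simps)
    then have "norm ((x + y) + (t + t') *\<^sub>R (c'' - x0)) \<le> norm (x + t *\<^sub>R (c - x0)) + norm (y + t' *\<^sub>R (c' - x0))"
      by (metis norm_triangle_ineq)
    then show "G (x + y) (r + s)" unfolding G_def using * c''
      by (intro exI[of _ "t + t'"] conjI bexI[of _ c'']) (auto simp: algebra_simps)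
  next
    fix s :: real and x r assume s: "s > 0" and "G x r"
    then obtain t c where *: "t \<ge> 0" "c \<in> C" "norm (x + t *\<^sub>R (c - x0)) - t * d \<le> r"
      by (auto simp: G_def)
    have "norm (s *\<^sub>R x + (s * t) *\<^sub>R (c - x0)) = norm (s *\<^sub>R (x + t *\<^sub>R (c - x0)))"
      by (simp add: scaleR_add_right)
    then have "norm (s *\<^sub>R x + (s * t) *\<^sub>R (c - x0)) - s * t * d = s * (norm (x + t *\<^sub>R (c - x0)) - t * d)"
      using s by (simp add: right_diff_distrib)
    also have "\<dots> \<le> s * r" using * s by simp
    finally show "G (s *\<^sub>R x) (s * r)" unfolding G_def using * s
      by (intro exI[of _ "s * t"] conjI bexI[of _ c]) auto
  next
    show "\<exists>r. G x r" for x using G_norm by blast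
    show "G 0 0" using G_norm[of 0] by simp
    show "0 \<le> r" if "G 0 r" for r using lb[OF that] by simp
  qed (rule lb)
  then obtain f where f: "linear f" "\<And>x. f x \<le> Inf {r. G x r}" using Hahn_Banach by blast
  have f_le: "f x \<le> r" if "G x r" for x r
  proof -
    have "Inf {r. G x r} \<le> r"
      using that lb by (intro cInf_lower bdd_belowI[of _ "- norm x"]) auto
    then show ?thesis using f(2)[of x] by simp
  qed
  interpret linear f by fact
  have abs: "\<bar>f x\<bar> \<le> norm x" for x
    using f_le[OF G_norm[of x]] f_le[OF G_norm[of "- x"]] by (simp add: neg)
  moreover have "bounded_linear f"
    by (rule bounded_linear_intro[where K=1]) (use abs in \<open>simp_all add: add scaleR\<close>)
  moreover have "f x0 + d \<le> f c" if "c \<in> C" for c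
  proof -
    have "G (x0 - c) (- d)" unfolding G_def by (rule exI[of _ 1]) (use that in \<open>auto intro!: bexI[of _ c]\<close>)
    from f_le[OF this] show ?thesis by (simp add: diff)
  qed
  ultimately show ?thesis by blast
qed

corollary norming_functional:
  fixes x :: "'a::real_normed_vector"
  shows "\<exists>f. bounded_linear f \<and> (\<forall>y. \<bar>f y\<bar> \<le> norm y) \<and> f x = norm x"
proof -
  obtain f where f: "bounded_linear f" "\<And>y. \<bar>f y\<bar> \<le> norm y" "f 0 + norm x \<le> f x"
    using convex_separation[of "{x}" "norm x" 0] by auto
  have "f x = norm x" using f(2)[of x] f(3) linear_simps(3)[OF f(1)] by simp
  then show ?thesis using f by blast
qed

section \<open>The uniform boundedness principle\<close>

text \<open>
  By Baire's theorem one of the closed sets \<open>{x. \<forall>T\<in>A. \<parallel>T x\<parallel> \<le> k}\<close> contains a ball;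
  differences of points of the ball then bound every \<open>T\<close> near 0, hence everywhere by scaling.
\<close>

theorem uniform_boundedness:
  fixes A :: "('a::{real_normed_vector,complete_space} \<Rightarrow> 'b::real_normed_vector) set"
  assumes lin: "\<And>T. T \<in> A \<Longrightarrow> bounded_linear T"
    and pointwise: "\<And>x. \<exists>M. \<forall>T\<in>A. norm (T x) \<le> M"
  shows "\<exists>M\<ge>0. \<forall>T\<in>A. \<forall>x. norm (T x) \<le> M * norm x"
proof -
  define E where "E k = {x. \<forall>T\<in>A. norm (T x) \<le> real k}" for k
  have closed: "closed (E k)" for k
  proof -
    have "E k = (\<Inter>T\<in>A. {x. norm (T x) \<le> real k})" by (auto simp: E_def)
    moreover have "closed {x. norm (T x) \<le> real k}" if "T \<in> A" for T
      using linear_continuous_on[OF lin[OF that], of UNIV] by (intro closed_Collect_le continuous_intros)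
    ultimately show ?thesis by auto
  qed
  have cover: "\<Union>(range E) = UNIV"
  proof -
    have "\<exists>k. x \<in> E k" for x
    proof -
      obtain M where M: "\<And>T. T \<in> A \<Longrightarrow> norm (T x) \<le> M" using pointwise by blast
      obtain k where "M \<le> real k" using real_arch_simple by blast
      then have "x \<in> E k" using M unfolding E_def by force
      then show ?thesis by blast
    qed
    then show ?thesis by blast
  qed
  have "\<exists>k. interior (E k) \<noteq> {}"
  proof (rule ccontr)
    assume "\<nexists>k. interior (E k) \<noteq> {}"
    then have "euclidean interior_of \<Union>(range E) = {}"
      using closed by (intro Baire_category_alt) (auto simp: completely_metrizable_space_euclidean)
    then show False by (simp add: cover)
  qed
  then obtain k x0 where "x0 \<in> interior (E k)" by blast
  then obtain e where e: "e > 0" "cball x0 e \<subseteq> E k"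
    by (meson mem_interior_cball)
  have "norm (T x) \<le> 2 * real k / e * norm x" if T: "T \<in> A" for T x
  proof (cases "x = 0")
    case True
    then show ?thesis using linear_simps(3)[OF lin[OF T]] by simp
  next
    case False
    interpret bounded_linear T using lin[OF T] .
    define y where "y = (e / norm x) *\<^sub>R x"
    have "norm y = e" using False e by (simp add: y_def)
    then have "x0 + y \<in> E k" "x0 \<in> E k" using e by (auto simp: dist_norm subset_iff)
    then have "norm (T (x0 + y)) \<le> k" "norm (T x0) \<le> k" using T by (auto simp: E_def)
    moreover have "T y = T (x0 + y) - T x0" by (simp add: add)
    ultimately have "norm (T y) \<le> 2 * real k"
      using norm_triangle_ineq4[of "T (x0 + y)" "T x0"] by simp
    moreover have "norm (T y) = e / norm x * norm (T x)" using e by (simp add: y_def scaleR)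
    ultimately show ?thesis using e False by (simp add: field_simps)
  qed
  then show ?thesis using e(1) by (intro exI[of _ "2 * real k / e"]) auto
qed

section \<open>Operators and functionals over the scalar field\<close>

definition operator :: "('k::real_or_complex \<Rightarrow> 'x::banach \<Rightarrow> 'x) \<Rightarrow> ('k \<Rightarrow> 'y::banach \<Rightarrow> 'y) \<Rightarrow> ('x \<Rightarrow> 'y) \<Rightarrow> bool"
  where "operator s t T \<longleftrightarrow> Vector_Spaces.linear s t T \<and> bounded_linear T"

lemma operatorD:
  assumes "operator s t T"
  shows "T (x + y) = T x + T y" "T (x - y) = T x - T y" "T 0 = 0" "T (s c x) = t c (T x)"
    "bounded_linear T"
  using assms unfolding operator_def Vector_Spaces.linear_iff
  by (auto simp: linear_simps)

lemma operatorI: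
  assumes "banach_over s" "banach_over t"
    and add: "\<And>x y. T (x + y) = T x + T y" and scale: "\<And>c x. T (s c x) = t c (T x)"
    and bound: "\<And>x. norm (T x) \<le> K * norm x"
  shows "operator s t T"
proof -
  interpret s: banach_over s by fact
  interpret t: banach_over t by fact
  have "bounded_linear T"
    by (rule bounded_linear_intro[where K=K])
      (use add bound scale in \<open>auto simp: mult.commute simp flip: s.scale_of_real t.scale_of_real\<close>)
  then show ?thesis
    unfolding operator_def Vector_Spaces.linear_iff
    using add scale s.vector_space_axioms t.vector_space_axioms by auto
qed

lemma operator_compose:
  assumes "operator s t T" "operator r s S"
  shows "operator r t (\<lambda>x. T (S x))"
  using assms bounded_linear_compose[of T S] Vector_Spaces.linear_compose[of r s S t T]
  by (auto simp: operator_def o_def)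

lemma operator_ident: "banach_over s \<Longrightarrow> operator s s (\<lambda>x. x)"
  by (rule operatorI[where K=1]) auto

lemma operator_add:
  assumes "banach_over s" "banach_over t" "operator s t S" "operator s t T"
  shows "operator s t (\<lambda>x. S x + T x)"
proof -
  interpret t: banach_over t by fact
  show ?thesis
    using assms bounded_linear_add[of S T]
    by (auto simp: operator_def Vector_Spaces.linear_iff t.scale_right_distrib)
qed

lemma operator_diff:
  assumes "banach_over s" "banach_over t" "operator s t S" "operator s t T"
  shows "operator s t (\<lambda>x. S x - T x)"
proof -
  interpret t: banach_over t by fact
  show ?thesis
    using assms bounded_linear_sub[of S T]
    by (auto simp: operator_def Vector_Spaces.linear_iff t.scale_right_diff_distrib)
qed

lemma bounded_linear_norm_le: "bounded_linear f \<Longrightarrow> \<exists>K\<ge>0. \<forall>x. norm (f x) \<le> K * norm x"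
  by (metis bounded_linear.nonneg_bounded mult.commute)

lemma dualI:
  assumes "banach_over s"
    and add: "\<And>x y. f (x + y) = f x + f y" and scale: "\<And>c x. f (s c x) = c * f x"
    and bound: "\<And>x. norm (f x) \<le> K * norm x"
  shows "f \<in> dual s"
proof -
  interpret s: banach_over s by fact
  have "bounded_linear f"
    by (rule bounded_linear_intro[where K=K])
      (use add bound scale in \<open>auto simp: mult.commute scaleR_conv_of_real simp flip: s.scale_of_real\<close>)
  moreover have "vector_space ((*) :: 'a \<Rightarrow> 'a \<Rightarrow> 'a)"
    by unfold_locales (auto simp: algebra_simps)
  ultimately show ?thesis
    unfolding dual_def Vector_Spaces.linear_iff
    using add scale s.vector_space_axioms linear_continuous_on by auto
qed

text \<open>
  Membership in the dual asks for continuity; boundedness follows from continuity at 0 by scaling.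
\<close>

lemma dualD:
  assumes "banach_over s" "f \<in> dual s"
  shows "f (x + y) = f x + f y" "f (x - y) = f x - f y" "f 0 = 0" "f (s c x) = c * f x" "bounded_linear f"
proof -
  interpret s: banach_over s by fact
  have add: "f (x + y) = f x + f y" and scale: "f (s c x) = c * f x" for c x y
    using assms(2) by (auto simp: dual_def Vector_Spaces.linear_iff)
  have scaleR: "f (r *\<^sub>R x) = r *\<^sub>R f x" for r x
    using scale by (simp add: scaleR_conv_of_real flip: s.scale_of_real)
  have zero: "f 0 = 0" using scale[of 0 0] by simp
  have "isCont f 0" using assms(2) by (simp add: dual_def continuous_on_eq_continuous_at)
  then obtain d where d: "d > 0" "\<And>x. norm x < d \<Longrightarrow> norm (f x) < 1"
    unfolding continuous_at_eps_delta by (metis diff_zero dist_norm zero zero_less_one)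
  have "norm (f x) \<le> norm x * (2 / d)" for x
  proof (cases "x = 0")
    case False
    then have "norm (f ((d / (2 * norm x)) *\<^sub>R x)) < 1" using d(1) by (intro d(2)) simp
    then show ?thesis using False d(1) by (simp add: scaleR field_simps)
  qed (simp add: zero)
  then show bl: "bounded_linear f" by (rule bounded_linear_intro[OF add scaleR])
  show "f (x + y) = f x + f y" "f (s c x) = c * f x" "f 0 = 0" by (fact add scale zero)+
  show "f (x - y) = f x - f y" using bl by (simp add: linear_simps)
qed

lemma dual_add:
  assumes "banach_over s" "f \<in> dual s" "g \<in> dual s"
  shows "(\<lambda>x. f x + g x) \<in> dual s"
proof -
  note f = dualD[OF assms(1,2)] and g = dualD[OF assms(1,3)]
  obtain K where K: "\<And>x. norm (f x + g x) \<le> K * norm x"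
    using bounded_linear_norm_le[OF bounded_linear_add[OF f(5) g(5)]] by blast
  show ?thesis
    by (rule dualI[OF assms(1), where K=K]) (auto simp: f(1,4) g(1,4) distrib_left K)
qed

lemma dual_mult:
  assumes "banach_over s" "f \<in> dual s"
  shows "(\<lambda>x. c * f x) \<in> dual s"
proof -
  note f = dualD[OF assms]
  obtain K where K: "\<And>x. norm (f x) \<le> K * norm x" using bounded_linear_norm_le[OF f(5)] by blast
  show ?thesis
    by (rule dualI[OF assms(1), where K="norm c * K"])
      (auto simp: f(1,4) distrib_left norm_mult K mult_left_mono mult.assoc mult.left_commute[of c])
qed

lemma dual_compose:
  assumes "banach_over t" "banach_over s" "f \<in> dual t" "operator s t T"
  shows "(\<lambda>x. f (T x)) \<in> dual s"
proof -
  note T = operatorD[OF assms(4)] and f = dualD[OF assms(1,3)]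
  obtain K where "\<And>x. norm (f (T x)) \<le> K * norm x"
    using bounded_linear_norm_le[OF bounded_linear_compose[OF f(5) T(5)]] by blast
  then show ?thesis by (intro dualI[OF assms(2), where K=K]) (simp_all add: T f)
qed

lemma conjg_dual:
  assumes "banach_over s" "f \<in> dual s"
  shows "(\<lambda>x. conjg (f x)) \<in> antidual s"
  using assms dualD[OF assms] bounded_linear.continuous_on[OF bounded_linear_conjg, of UNIV f]
  by (auto simp: dual_def antidual_def antilinear_def conjg_add conjg_mult)

text \<open>
  The bridge from the Hahn-Banach theorem, which yields real functionals, to functionals that are
  linear over the scalar field.
\<close>

lemma dual_of_real_functional:
  fixes s :: "'k::real_or_complex \<Rightarrow> 'x::banach \<Rightarrow> 'x"
  assumes "banach_over s" and f: "bounded_linear (f :: 'x \<Rightarrow> real)"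
  shows "\<exists>F\<in>dual s. \<forall>x. re (F x) = f x"
proof -
  interpret s: banach_over s by fact
  interpret f: bounded_linear f by fact
  interpret re: bounded_linear "re :: 'k \<Rightarrow> real" by (rule bounded_linear_re)
  have "\<exists>k. \<forall>c. f (s c x) = re (c * k)" for x
    by (rule real_functional_eq_re_mult, rule linearI)
      (auto simp: s.scale_left_distrib f.add f.scaleR scaleR_conv_of_real s.scale_of_real
        simp flip: s.scale_scale)
  then obtain F where F: "\<And>x c. f (s c x) = re (c * F x)" by metis
  obtain K where K: "K \<ge> 0" "\<And>x. norm (f x) \<le> K * norm x"
    using bounded_linear_norm_le[OF f] by blast
  have "F \<in> dual s"
  proof (rule dualI[OF assms(1)])
    show "F (x + y) = F x + F y" for x y
      by (rule re_mult_ext) (simp add: distrib_left re.add s.scale_right_distrib f.add flip: F)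
    show "F (s c x) = c * F x" for c x
      by (rule re_mult_ext) (simp flip: F mult.assoc)
    show "norm (F x) \<le> K * norm x" for x
    proof (cases "F x = 0")
      case True
      then show ?thesis using K(1) by simp
    next
      case False
      have "(norm (F x))\<^sup>2 = f (s (conjg (F x)) x)" by (simp add: F re_conjg_mult_self)
      also have "\<dots> \<le> K * (norm (F x) * norm x)"
        using K(2)[of "s (conjg (F x)) x"] by (simp add: s.norm_scale norm_conjg)
      finally show ?thesis using False by (simp add: power2_eq_square)
    qed
  qed
  moreover have "re (F x) = f x" for x using F[of 1 x] by simp
  ultimately show ?thesis by blast
qed

lemma dual_separates_zero:
  fixes s :: "'k::real_or_complex \<Rightarrow> 'x::banach \<Rightarrow> 'x"
  assumes "banach_over s" "y \<noteq> 0"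
  shows "\<exists>g\<in>dual s. g y = 1"
proof -
  obtain f where f: "bounded_linear f" "f y = norm y" using norming_functional by blast
  obtain F where F: "F \<in> dual s" "\<And>x. re (F x) = f x" using dual_of_real_functional[OF assms(1) f(1)] by blast
  have "re (F y) \<noteq> re (0 :: 'k)"
    using F(2)[of y] f(2) assms(2) linear_simps(3)[OF bounded_linear_re[where 'k='k]] by simp
  then have Fy: "F y \<noteq> 0" by auto
  note D = dualD[OF assms(1) F(1)]
  obtain K where K: "\<And>x. norm (F x) \<le> K * norm x" using bounded_linear_norm_le[OF D(5)] by blast
  have "(\<lambda>x. F x / F y) \<in> dual s"
    by (rule dualI[OF assms(1), where K="K / norm (F y)"])
      (auto simp: D add_divide_distrib norm_divide K divide_right_mono)
  then show ?thesis using Fy by (intro bexI) auto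
qed

text \<open>
  Reflexivity in the form in which separation uses it: a bounded real-linear \<open>\<psi>\<close> on the dual is the
  real part of an element of the bidual, and the latter is evaluation at a vector.
\<close>

lemma reflexive_space_real_functional:
  fixes s :: "'k::real_or_complex \<Rightarrow> 'x::banach \<Rightarrow> 'x"
  assumes "banach_over s" "reflexive_space s"
    and add: "\<And>f g. f \<in> dual s \<Longrightarrow> g \<in> dual s \<Longrightarrow> \<psi> (\<lambda>x. f x + g x) = \<psi> f + \<psi> g"
    and scaleR: "\<And>r f. f \<in> dual s \<Longrightarrow> \<psi> (\<lambda>x. of_real r * f x) = r * \<psi> f"
    and bound: "\<And>f. f \<in> dual s \<Longrightarrow> \<bar>\<psi> f\<bar> \<le> K * onorm f"
  shows "\<exists>x. \<forall>f\<in>dual s. \<psi> f = re (f x)"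
proof -
  interpret s: banach_over s by fact
  interpret re: bounded_linear "re :: 'k \<Rightarrow> real" by (rule bounded_linear_re)
  note D = dualD[OF assms(1)]
  note mult = dual_mult[OF assms(1)]
  have onorm_mult: "onorm (\<lambda>x. c * f x) \<le> norm c * onorm f" if "f \<in> dual s" for c f
    using onorm[OF D(5)[OF that]] onorm_pos_le[OF D(5)[OF that]]
    by (intro onorm_bound) (auto simp: norm_mult mult_left_mono mult.assoc)
  have "\<exists>k. \<forall>c. \<psi> (\<lambda>x. c * f x) = re (c * k)" if "f \<in> dual s" for f
  proof (rule real_functional_eq_re_mult, rule linearI)
    show "\<psi> (\<lambda>x. (c + c') * f x) = \<psi> (\<lambda>x. c * f x) + \<psi> (\<lambda>x. c' * f x)" for c c'
      using add[OF mult[OF that] mult[OF that]] by (simp add: distrib_right)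
    show "\<psi> (\<lambda>x. (r *\<^sub>R c) * f x) = r *\<^sub>R \<psi> (\<lambda>x. c * f x)" for r c
      using scaleR[OF mult[OF that], of r c] by (simp add: scaleR_conv_of_real mult.assoc)
  qed
  then obtain \<Psi> where \<Psi>: "\<And>f c. f \<in> dual s \<Longrightarrow> \<psi> (\<lambda>x. c * f x) = re (c * \<Psi> f)" by metis
  have "\<Psi> \<in> bidual s"
    unfolding bidual_def
  proof (intro CollectI conjI ballI allI)
    fix f g assume fg: "f \<in> dual s" "g \<in> dual s"
    show "\<Psi> (\<lambda>x. f x + g x) = \<Psi> f + \<Psi> g"
    proof (rule re_mult_ext)
      fix c
      have "re (c * \<Psi> (\<lambda>x. f x + g x)) = \<psi> (\<lambda>x. c * f x + c * g x)"
        using \<Psi>[OF dual_add[OF assms(1) fg], of c] by (simp add: distrib_left)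
      also have "\<dots> = re (c * (\<Psi> f + \<Psi> g))"
        using add[OF mult mult, OF fg] \<Psi>[OF fg(1)] \<Psi>[OF fg(2)] by (simp add: distrib_left re.add)
      finally show "re (c * \<Psi> (\<lambda>x. f x + g x)) = re (c * (\<Psi> f + \<Psi> g))" .
    qed
  next
    fix c f assume f: "f \<in> dual s"
    show "\<Psi> (\<lambda>x. c * f x) = c * \<Psi> f"
    proof (rule re_mult_ext)
      fix c'
      show "re (c' * \<Psi> (\<lambda>x. c * f x)) = re (c' * (c * \<Psi> f))"
        using \<Psi>[OF mult[OF f, of c], of c'] \<Psi>[OF f, of "c' * c"] by (simp add: mult.assoc)
    qed
  next
    have "norm (\<Psi> f) \<le> \<bar>K\<bar> * onorm f" if f: "f \<in> dual s" for f
    proof (cases "\<Psi> f = 0")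
      case True
      then show ?thesis using onorm_pos_le[OF D(5)[OF f]] by simp
    next
      case False
      have "(norm (\<Psi> f))\<^sup>2 = \<psi> (\<lambda>x. conjg (\<Psi> f) * f x)" by (simp add: \<Psi>[OF f] re_conjg_mult_self)
      also have "\<dots> \<le> K * onorm (\<lambda>x. conjg (\<Psi> f) * f x)" using bound[OF mult[OF f, of "conjg (\<Psi> f)"]] by simp
      also have "\<dots> \<le> \<bar>K\<bar> * onorm (\<lambda>x. conjg (\<Psi> f) * f x)"
        using onorm_pos_le[OF D(5)[OF mult[OF f]]] by (intro mult_right_mono) auto
      also have "\<dots> \<le> \<bar>K\<bar> * (norm (\<Psi> f) * onorm f)"
        using onorm_mult[OF f, of "conjg (\<Psi> f)"] by (intro mult_left_mono) (auto simp: norm_conjg)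
      finally show ?thesis using False by (simp add: power2_eq_square)
    qed
    then show "\<exists>C. \<forall>f\<in>dual s. norm (\<Psi> f) \<le> C * onorm f" by blast
  qed
  then obtain x where "\<And>f. f \<in> dual s \<Longrightarrow> \<Psi> f = f x"
    using assms(2) unfolding reflexive_space_def by blast
  then have "\<psi> f = re (f x)" if "f \<in> dual s" for f
    using \<Psi>[OF that, of 1] that by simp
  then show ?thesis by blast
qed

section \<open>Finite rank operators\<close>

lemma fin_dim_subspaceI:
  assumes "vector_space s" "module.subspace s S" "S \<subseteq> module.span s B" "finite B"
  shows "fin_dim_subspace s S"
proof -
  interpret vector_space s by fact
  obtain A where A: "A \<subseteq> S" "independent A" "S \<subseteq> span A"
    by (rule maximal_independent_subset)
  have "A \<subseteq> span B" using A(1) assms(3) by blast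
  then have "finite A" using independent_span_bound[OF assms(4) A(2)] by simp
  moreover have "S = span A" by (rule equalityI[OF A(3) span_minimal[OF A(1) assms(2)]])
  ultimately show ?thesis unfolding fin_dim_subspace_def by (intro exI[of _ A] conjI)
qed

lemma fin_dim_subspace_basis:
  assumes "vector_space s" "fin_dim_subspace s S"
  obtains B where "finite B" "S = module.span s B" "card B = vector_space.dim s S"
proof -
  interpret vector_space s by fact
  obtain B where B: "finite B" "S = span B" using assms(2) unfolding fin_dim_subspace_def by blast
  obtain A where A: "A \<subseteq> S" "independent A" "S \<subseteq> span A" "card A = dim S"
    by (rule basis_exists)
  have "finite A" using independent_span_bound[OF B(1) A(2)] A(1) B(2) by simp
  moreover have "S = span A" using A(3) span_minimal[OF A(1)] B(2) subspace_span by (metis equalityI)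
  ultimately show thesis using A(4) by (rule that)
qed

lemma operator_rank_one:
  assumes "banach_over s" "f \<in> dual s"
  shows "operator s s (\<lambda>x. s (f x) y)"
proof -
  interpret s: banach_over s by fact
  note D = dualD[OF assms]
  obtain K where K: "\<And>x. norm (f x) \<le> K * norm x" using bounded_linear_norm_le[OF D(5)] by blast
  have "norm (f x) * norm y \<le> K * norm y * norm x" for x
    using mult_right_mono[OF K[of x], of "norm y"] by (simp add: mult_ac)
  then show ?thesis
    by (intro operatorI[OF assms(1,1), where K="K * norm y"])
      (auto simp: D s.scale_left_distrib s.norm_scale)
qed

lemma operator_finite_sum:
  assumes "banach_over s" "finite B" "\<And>b. b \<in> B \<Longrightarrow> f b \<in> dual s"
  shows "operator s s (\<lambda>x. \<Sum>b\<in>B. s (f b x) (y b))"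
  using assms(2,3)
proof (induction B rule: finite_induct)
  case empty
  interpret banach_over s by fact
  show ?case by (rule operatorI[OF assms(1,1), where K=0]) auto
next
  case (insert b B)
  then show ?case using operator_add[OF assms(1,1) operator_rank_one[OF assms(1)]] by simp
qed

text \<open>
  A finite dimensional subspace is the range of a bounded projection of the form
  \<open>x \<mapsto> \<Sum> f\<^sub>b(x) y\<^sub>b\<close> with bounded functionals. When a vector \<open>b\<close> is added to the spanning set, the new
  summand is \<open>h(x) e\<close>, where \<open>e = b - R b\<close> is the part of \<open>b\<close> that the old projection \<open>R\<close> misses and
  \<open>h\<close> vanishes on the old subspace with \<open>h(b) = 1\<close>, unless \<open>e = 0\<close>.
\<close>

lemma finite_dim_projection:
  fixes s :: "'k::real_or_complex \<Rightarrow> 'x::banach \<Rightarrow> 'x"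
  assumes "banach_over s" "finite B"
  shows "\<exists>f y. (\<forall>b\<in>B. f b \<in> dual s \<and> y b \<in> module.span s B) \<and>
    (\<forall>x\<in>module.span s B. (\<Sum>b\<in>B. s (f b x) (y b)) = x)"
  using assms(2)
proof (induction B rule: finite_induct)
  case empty
  interpret banach_over s by fact
  show ?case by auto
next
  case (insert b B)
  interpret banach_over s by fact
  obtain f y where fy: "\<And>b. b \<in> B \<Longrightarrow> f b \<in> dual s" "\<And>b. b \<in> B \<Longrightarrow> y b \<in> span B"
    "\<And>x. x \<in> span B \<Longrightarrow> (\<Sum>b\<in>B. s (f b x) (y b)) = x" using insert.IH by blast
  define R where "R x = (\<Sum>b\<in>B. s (f b x) (y b))" for x
  have R: "operator s s R" unfolding R_def using operator_finite_sum[OF assms(1) insert(1) fy(1)] .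
  note RD = operatorD[OF R]
  have R_in: "R x \<in> span B" for x unfolding R_def by (intro span_sum span_scale fy(2))
  have R_fix: "R x = x" if "x \<in> span B" for x using fy(3)[OF that] by (simp add: R_def)
  define e where "e = b - R b"
  have "\<exists>h\<in>dual s. (\<forall>x\<in>span B. h x = 0) \<and> s (h b) e = e"
  proof (cases "e = 0")
    case True
    have "(\<lambda>x. 0) \<in> dual s" by (rule dualI[OF assms(1), where K=0]) auto
    then show ?thesis using True by (intro bexI) auto
  next
    case False
    then obtain g where g: "g \<in> dual s" "g e = 1" using dual_separates_zero[OF assms(1)] by blast
    have "(\<lambda>x. g (x - R x)) \<in> dual s"
      using dual_compose[OF assms(1,1) g(1) operator_diff[OF assms(1,1) operator_ident[OF assms(1)] R]] .
    then show ?thesis using g R_fix dualD(3)[OF assms(1) g(1)]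
      by (intro bexI[of _ "\<lambda>x. g (x - R x)"]) (auto simp: e_def)
  qed
  then obtain h where h: "h \<in> dual s" "\<And>x. x \<in> span B \<Longrightarrow> h x = 0" "s (h b) e = e" by blast
  note hD = dualD[OF assms(1) h(1)]
  have "e \<in> span (insert b B)"
    unfolding e_def using R_in span_mono[of B "insert b B"] by (intro span_diff) (auto intro: span_base)
  moreover have "s (h x) e + R x = x" if x: "x \<in> span (insert b B)" for x
  proof -
    obtain k where k: "x - s k b \<in> span B" using x by (auto simp: span_breakdown_eq)
    define w where "w = x - s k b"
    have x_eq: "x = w + s k b" by (simp add: w_def)
    have w: "R w = w" "h w = 0" using k R_fix h(2) by (auto simp: w_def)
    have "s (h x) e + R x = s k (s (h b) e) + (w + s k (R b))"
      by (simp add: x_eq RD hD w)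
    also have "\<dots> = s k (e + R b) + w" by (simp add: h(3) scale_right_distrib)
    also have "\<dots> = x" by (simp add: e_def x_eq)
    finally show ?thesis .
  qed
  moreover have "(\<Sum>b'\<in>B. s ((f(b := h)) b' x) ((y(b := e)) b')) = R x" for x
    unfolding R_def using insert(2) by (intro sum.cong) auto
  moreover have "span B \<subseteq> span (insert b B)" by (intro span_mono) auto
  ultimately show ?case
    using insert(1,2) fy(1,2) h(1)
    by (intro exI[of _ "f(b := h)"] exI[of _ "y(b := e)"]) auto
qed

text \<open>
  Compose \<open>T\<close> with a bounded projection onto its range. The number of summands is exactly the rank,
  so that the formula can be used to compare ranks.
\<close>

lemma finite_rank_representation:
  fixes s :: "'k::real_or_complex \<Rightarrow> 'x::banach \<Rightarrow> 'x"
  assumes "banach_over s" "bounded_finite_rank s T"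
  shows "\<exists>(B :: 'x set) f y. finite B \<and> card B = vector_space.dim s (range T) \<and>
    (\<forall>b\<in>B. f b \<in> dual s) \<and> (\<forall>x. T x = (\<Sum>b\<in>B. s (f b x) (y b)))"
proof -
  interpret banach_over s by fact
  have T: "operator s s T" "fin_dim_subspace s (range T)"
    using assms(2) by (auto simp: bounded_finite_rank_def operator_def)
  obtain B where B: "finite B" "range T = span B" "card B = dim (range T)"
    using fin_dim_subspace_basis[OF vector_space_axioms T(2)] by blast
  obtain f y where fy: "\<And>b. b \<in> B \<Longrightarrow> f b \<in> dual s" "\<And>x. x \<in> span B \<Longrightarrow> (\<Sum>b\<in>B. s (f b x) (y b)) = x"
    using finite_dim_projection[OF assms(1) B(1)] by blast
  have "T x = (\<Sum>b\<in>B. s (f b (T x)) (y b))" for x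
    using fy(2)[of "T x"] B(2) rangeI[of T x] by simp
  then show ?thesis
    using dual_compose[OF assms(1,1) fy(1) T(1)] B(1,3)
    by (intro exI[of _ B] exI[of _ "\<lambda>b x. f b (T x)"] exI[of _ y]) blast
qed

section \<open>Enlarging a finite rank projection\<close>

lemma bounded_finite_rankI:
  assumes "banach_over s" "operator s s T" "finite B" "range T \<subseteq> module.span s B"
  shows "bounded_finite_rank s T"
proof -
  interpret banach_over s by fact
  interpret T: Vector_Spaces.linear s s T using assms(2) by (simp add: operator_def)
  have "subspace (range T)" by (rule T.subspace_image[OF subspace_UNIV])
  then show ?thesis
    using fin_dim_subspaceI[OF vector_space_axioms _ assms(4,3)] assms(2)
    by (simp add: bounded_finite_rank_def operator_def)
qed

lemma bounded_finite_rankE: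
  assumes "bounded_finite_rank s T"
  obtains B where "operator s s T" "finite B" "range T = module.span s B"
  using assms that by (auto simp: bounded_finite_rank_def operator_def fin_dim_subspace_def)

lemma bounded_finite_rank_compose:
  assumes "banach_over s" "operator s s S" "bounded_finite_rank s T" "operator s s J"
  shows "bounded_finite_rank s (\<lambda>x. J (T (S x)))"
proof -
  obtain B where T: "operator s s T" and B: "finite B" "range T = module.span s B"
    using assms(3) by (rule bounded_finite_rankE)
  interpret J: Vector_Spaces.linear s s J using assms(4) by (simp add: operator_def)
  have "range (\<lambda>x. J (T (S x))) \<subseteq> module.span s (J ` B)"
    using B(2) by (force simp: J.span_image)
  then show ?thesis
    using B(1) operator_compose[OF assms(4) operator_compose[OF T assms(2)]]
    by (intro bounded_finite_rankI[OF assms(1), of _ "J ` B"]) auto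
qed

text \<open>
  Pointwise convergence is uniform on the range of a finite rank operator, since by
  \<open>finite_rank_representation\<close> only finitely many vectors \<open>y\<^sub>b\<close> matter.
\<close>

lemma pointwise_limit_uniform_on_finite_rank:
  assumes "banach_over s" "bounded_finite_rank s R"
    and P: "\<And>n. n \<ge> 1 \<Longrightarrow> operator s s (P n)" and lim: "\<And>x. (\<lambda>n. P n x) \<longlonglongrightarrow> x" and "\<epsilon> > 0"
  shows "\<exists>n\<ge>1::nat. \<forall>x. norm (R x - P n (R x)) \<le> \<epsilon> * norm x"
proof -
  interpret banach_over s by fact
  obtain B :: "'b set" and f y where B: "finite B" and f: "\<And>b. b \<in> B \<Longrightarrow> f b \<in> dual s"
    and R: "\<And>x. R x = (\<Sum>b\<in>B. s (f b x) (y b))"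
    using finite_rank_representation[OF assms(1,2)] by (elim exE conjE) (rule that, auto)
  have "(\<lambda>n. \<Sum>b\<in>B. onorm (f b) * norm (y b - P n (y b))) \<longlonglongrightarrow> (\<Sum>b\<in>B. onorm (f b) * norm (y b - y b))"
    by (intro tendsto_intros lim)
  then have "eventually (\<lambda>n. (\<Sum>b\<in>B. onorm (f b) * norm (y b - P n (y b))) < \<epsilon>) sequentially"
    using \<open>\<epsilon> > 0\<close> by (auto dest: order_tendstoD(2)[of _ _ _ \<epsilon>])
  then obtain N where "\<And>n. n \<ge> N \<Longrightarrow> (\<Sum>b\<in>B. onorm (f b) * norm (y b - P n (y b))) < \<epsilon>"
    unfolding eventually_sequentially by blast
  then obtain n where n: "n \<ge> 1" "(\<Sum>b\<in>B. onorm (f b) * norm (y b - P n (y b))) < \<epsilon>"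
    by (meson max.cobounded1 max.cobounded2)
  have "norm (R x - P n (R x)) \<le> \<epsilon> * norm x" for x
  proof -
    interpret Pn: Vector_Spaces.linear s s "P n" using P[OF n(1)] by (simp add: operator_def)
    have "R x - P n (R x) = (\<Sum>b\<in>B. s (f b x) (y b - P n (y b)))"
      by (simp add: R Pn.sum Pn.scale scale_right_diff_distrib sum_subtractf)
    also have "norm \<dots> \<le> (\<Sum>b\<in>B. onorm (f b) * norm x * norm (y b - P n (y b)))"
      using onorm[OF dualD(5)[OF assms(1) f]] by (intro sum_norm_le) (auto simp: norm_scale intro!: mult_right_mono)
    also have "\<dots> = (\<Sum>b\<in>B. onorm (f b) * norm (y b - P n (y b))) * norm x"
      by (simp add: sum_distrib_left mult_ac)
    also have "\<dots> \<le> \<epsilon> * norm x" using n(2) by (intro mult_right_mono) auto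
    finally show ?thesis .
  qed
  then show ?thesis using n(1) by blast
qed

text \<open>
  Mazur's lemma for the operators \<open>Q P\<^sub>n\<close>. If \<open>Q\<close> had positive distance from all \<open>Q W\<close> in the operator
  norm, a functional \<open>\<Phi>\<close> on operators would separate it from them. As \<open>Q\<close> is a finite sum of operators
  \<open>f\<^sub>b(\<cdot>) y\<^sub>b\<close>, only the functionals \<open>g \<mapsto> \<Phi>(g(\<cdot>) y\<^sub>b)\<close> on the dual matter, and by reflexivity these are
  real parts of evaluations at vectors \<open>x\<^sub>b\<close>. So \<open>\<Phi>(Q P\<^sub>n)\<close> is the real part of
  \<open>\<Sum> f\<^sub>b(P\<^sub>n x\<^sub>b)\<close>, and pointwise convergence of \<open>P\<^sub>n\<close> gives \<open>\<Phi>(Q P\<^sub>n) \<longlonglongrightarrow> \<Phi>(Q)\<close>, a contradiction.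
\<close>

lemma convex_combination_approximates_from_left:
  fixes s :: "'k::real_or_complex \<Rightarrow> 'x::banach \<Rightarrow> 'x"
  assumes "banach_over s" "reflexive_space s" "bounded_finite_rank s Q"
    and P: "\<And>n. n \<ge> 1 \<Longrightarrow> operator s s (P n)" and lim: "\<And>x. (\<lambda>n. P n x) \<longlonglongrightarrow> x" and "\<epsilon> > 0"
  shows "\<exists>W\<in>convex hull ((\<lambda>n. Blinfun (P n)) ` {1::nat..}). \<forall>x. norm (Q (W x) - Q x) \<le> \<epsilon> * norm x"
proof (rule ccontr)
  interpret banach_over s by fact
  note D = dualD[OF assms(1)]
  define H where "H = convex hull ((\<lambda>n. Blinfun (P n)) ` {1::nat..})"
  define q where "q = Blinfun Q"
  assume "\<not> (\<exists>W\<in>convex hull ((\<lambda>n. Blinfun (P n)) ` {1::nat..}). \<forall>x. norm (Q (W x) - Q x) \<le> \<epsilon> * norm x)"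
  then have none: "\<exists>x. norm (Q (blinfun_apply W x) - Q x) > \<epsilon> * norm x" if "W \<in> H" for W
    using that by (auto simp: H_def not_le)
  have "bounded_linear Q" using assms(3) by (simp add: bounded_finite_rank_def)
  then have q: "blinfun_apply q = Q" by (simp add: q_def bounded_linear_Blinfun_apply)
  have Pn: "blinfun_apply (Blinfun (P n)) = P n" if "n \<ge> 1" for n
    using operatorD(5)[OF P[OF that]] by (simp add: bounded_linear_Blinfun_apply)
  have far: "\<epsilon> \<le> norm (c - q)" if "c \<in> (\<lambda>W. q o\<^sub>L W) ` H" for c
  proof (rule ccontr)
    assume "\<not> \<epsilon> \<le> norm (c - q)"
    then have less: "norm (c - q) < \<epsilon>" by simp
    from that obtain W where W: "W \<in> H" "c = q o\<^sub>L W" by blast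
    from none[OF W(1)] obtain x where x: "norm (Q (blinfun_apply W x) - Q x) > \<epsilon> * norm x" by blast
    have "norm (Q (blinfun_apply W x) - Q x) = norm (blinfun_apply (c - q) x)"
      by (simp add: W q blinfun.diff_left)
    also have "\<dots> \<le> norm (c - q) * norm x" by (rule norm_blinfun)
    also have "\<dots> \<le> \<epsilon> * norm x" using less by (intro mult_right_mono) auto
    finally show False using x by simp
  qed
  have "convex ((\<lambda>W. q o\<^sub>L W) ` H)"
    by (intro convex_linear_image bounded_linear.linear bounded_linear_intros) (simp add: H_def)
  moreover have PH: "Blinfun (P n) \<in> H" if "n \<ge> 1" for n
    unfolding H_def using that by (intro hull_inc) auto
  then have "(\<lambda>W. q o\<^sub>L W) ` H \<noteq> {}" by blast
  ultimately have "\<exists>\<Phi>. bounded_linear \<Phi> \<and> (\<forall>A. \<bar>\<Phi> A\<bar> \<le> norm A) \<and> (\<forall>c\<in>(\<lambda>W. q o\<^sub>L W) ` H. \<Phi> q + \<epsilon> \<le> \<Phi> c)"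
    using far less_imp_le[OF \<open>\<epsilon> > 0\<close>] by (rule convex_separation)
  then obtain \<Phi> where \<Phi>: "bounded_linear \<Phi>" "\<And>A. \<bar>\<Phi> A\<bar> \<le> norm A"
    "\<And>W. W \<in> H \<Longrightarrow> \<Phi> q + \<epsilon> \<le> \<Phi> (q o\<^sub>L W)"
    by blast
  interpret \<Phi>: bounded_linear \<Phi> by fact
  obtain B :: "'x set" and f y where B: "finite B" and f: "\<And>b. b \<in> B \<Longrightarrow> f b \<in> dual s"
    and Q: "\<And>x. Q x = (\<Sum>b\<in>B. s (f b x) (y b))"
    using finite_rank_representation[OF assms(1,3)] by (elim exE conjE) (rule that, auto)
  define r where "r b g = Blinfun (\<lambda>x. s (g x) (y b))" for b and g :: "'x \<Rightarrow> 'k"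
  have r: "blinfun_apply (r b g) = (\<lambda>x. s (g x) (y b))" if "g \<in> dual s" for b g
    unfolding r_def using operatorD(5)[OF operator_rank_one[OF assms(1) that]]
    by (rule bounded_linear_Blinfun_apply)
  have "\<exists>x. \<forall>g\<in>dual s. \<Phi> (r b g) = re (g x)" for b
  proof (rule reflexive_space_real_functional[OF assms(1,2), where K="norm (y b)"])
    fix g h assume gh: "g \<in> dual s" "h \<in> dual s"
    have "r b (\<lambda>x. g x + h x) = r b g + r b h"
      by (rule blinfun_eqI) (simp add: r gh dual_add[OF assms(1)] blinfun.add_left scale_left_distrib)
    then show "\<Phi> (r b (\<lambda>x. g x + h x)) = \<Phi> (r b g) + \<Phi> (r b h)" by (simp add: \<Phi>.add)
  next
    fix c g assume g: "g \<in> dual s"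
    have "r b (\<lambda>x. of_real c * g x) = c *\<^sub>R r b g"
      by (rule blinfun_eqI) (simp add: r g dual_mult[OF assms(1)] blinfun.scaleR_left flip: scale_of_real)
    then show "\<Phi> (r b (\<lambda>x. of_real c * g x)) = c * \<Phi> (r b g)" by (simp add: \<Phi>.scaleR)
  next
    fix g assume g: "g \<in> dual s"
    have "norm (s (g x) (y b)) \<le> norm (y b) * onorm g * norm x" for x
      using mult_left_mono[OF onorm[OF D(5)[OF g], of x], of "norm (y b)"] by (simp add: norm_scale mult_ac)
    then have "norm (r b g) \<le> norm (y b) * onorm g"
      using onorm_pos_le[OF D(5)[OF g]] by (intro norm_blinfun_bound) (auto simp: r g)
    then show "\<bar>\<Phi> (r b g)\<bar> \<le> norm (y b) * onorm g" using \<Phi>(2) order_trans by blast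
  qed
  then obtain x where x: "\<And>b g. g \<in> dual s \<Longrightarrow> \<Phi> (r b g) = re (g (x b))" by metis
  have "q = (\<Sum>b\<in>B. r b (f b))"
    by (rule blinfun_eqI) (simp add: q Q blinfun.sum_left r f)
  then have \<Phi>q: "\<Phi> q = (\<Sum>b\<in>B. re (f b (x b)))" by (simp add: \<Phi>.sum x f)
  have "\<Phi> (q o\<^sub>L Blinfun (P n)) = (\<Sum>b\<in>B. re (f b (P n (x b))))" if n: "n \<ge> 1" for n
  proof -
    have fP: "(\<lambda>z. f b (P n z)) \<in> dual s" if "b \<in> B" for b
      using dual_compose[OF assms(1,1) f[OF that] P[OF n]] .
    have "q o\<^sub>L Blinfun (P n) = (\<Sum>b\<in>B. r b (\<lambda>z. f b (P n z)))"
      by (rule blinfun_eqI) (simp add: q Q blinfun.sum_left r fP Pn[OF n])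
    then show ?thesis by (simp add: \<Phi>.sum x fP)
  qed
  then have ge: "\<Phi> q + \<epsilon> \<le> (\<Sum>b\<in>B. re (f b (P n (x b))))" if "n \<ge> 1" for n
    using \<Phi>(3)[OF PH[OF that]] that by simp
  have "(\<lambda>n. \<Sum>b\<in>B. re (f b (P n (x b)))) \<longlonglongrightarrow> (\<Sum>b\<in>B. re (f b (x b)))"
    by (intro tendsto_sum bounded_linear.tendsto[OF bounded_linear_re]
      bounded_linear.tendsto[OF D(5)[OF f]] lim)
  then have "\<Phi> q + \<epsilon> \<le> (\<Sum>b\<in>B. re (f b (x b)))"
    using ge by (intro LIMSEQ_le_const) auto
  then show False using \<Phi>q \<open>\<epsilon> > 0\<close> by simp
qed

text \<open>
  The equation \<open>x - A x = y\<close> is a fixed point problem for the contraction \<open>x \<mapsto> y + A x\<close>.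
\<close>

lemma near_identity_invertible:
  fixes s :: "'k::real_or_complex \<Rightarrow> 'x::banach \<Rightarrow> 'x"
  assumes "banach_over s" "operator s s A" and small: "\<And>x. norm (A x) \<le> norm x / 2"
  shows "\<exists>J. operator s s J \<and> (\<forall>x. J (x - A x) = x) \<and> (\<forall>y. J y - A (J y) = y) \<and>
    (\<forall>y. norm (J y) \<le> 2 * norm y)"
proof -
  interpret banach_over s by fact
  note A = operatorD[OF assms(2)]
  have lower: "norm x \<le> 2 * norm (x - A x)" for x
    using norm_triangle_ineq2[of x "A x"] small[of x] by simp
  have inj: "x = x'" if "x - A x = x' - A x'" for x x'
  proof -
    have "(x - x') - A (x - x') = 0" using that by (simp add: A algebra_simps)
    then show ?thesis using lower[of "x - x'"] by simp
  qed
  have "\<exists>!x. y + A x = x" for y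
    by (rule banach_fix_type[of "1/2"])
      (use small in \<open>auto simp: dist_norm simp flip: A(2)\<close>)
  then have "\<exists>x. x - A x = y" for y by (metis add_diff_cancel_right')
  then obtain J where J: "\<And>y. J y - A (J y) = y" by metis
  have bound: "norm (J y) \<le> 2 * norm y" for y using lower[of "J y"] J[of y] by simp
  have "operator s s J"
  proof (rule operatorI[OF assms(1,1), where K=2])
    show "J (x + y) = J x + J y" for x y
    proof (rule inj)
      have "J x + J y - A (J x + J y) = (J x - A (J x)) + (J y - A (J y))" by (simp add: A)
      then show "J (x + y) - A (J (x + y)) = J x + J y - A (J x + J y)" by (simp add: J)
    qed
    show "J (s c x) = s c (J x)" for c x
    proof (rule inj)
      have "s c (J x) - A (s c (J x)) = s c (J x - A (J x))" by (simp add: A scale_right_diff_distrib)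
      then show "J (s c x) - A (J (s c x)) = s c (J x) - A (s c (J x))" by (simp add: J)
    qed
  qed (rule bound)
  moreover have "J (x - A x) = x" for x by (rule inj) (rule J)
  ultimately show ?thesis using J bound by blast
qed

text \<open>
  Let \<open>R\<close> be a bounded projection onto the given subspace. For large \<open>n\<close> the operator \<open>S = 1 - (R - P\<^sub>n R)\<close>
  is close to the identity, and it maps \<open>x\<close> in the subspace to \<open>P\<^sub>n x\<close>. Hence the conjugate
  \<open>S\<^sup>-\<^sup>1 P\<^sub>n S\<close> fixes these \<open>x\<close>. However large the norm of \<open>R\<close> is, the norms of \<open>S\<close> and \<open>S\<^sup>-\<^sup>1\<close>
  are at most 2, so the bound \<open>4 K\<close> is independent of the subspace.
\<close>

lemma projection_containing_finite_dim:
  fixes s :: "'k::real_or_complex \<Rightarrow> 'x::banach \<Rightarrow> 'x"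
  assumes "banach_over s"
    and P: "\<And>n. n \<ge> 1 \<Longrightarrow> bounded_finite_rank s (P n)" "\<And>n x. n \<ge> 1 \<Longrightarrow> P n (P n x) = P n x"
      "\<And>n x. n \<ge> 1 \<Longrightarrow> norm (P n x) \<le> K * norm x"
    and lim: "\<And>x. (\<lambda>n::nat. P n x) \<longlonglongrightarrow> x" and "finite B"
  shows "\<exists>P'. bounded_finite_rank s P' \<and> (\<forall>x. P' (P' x) = P' x) \<and> (\<forall>x. norm (P' x) \<le> 4 * K * norm x) \<and>
    (\<forall>x\<in>module.span s B. P' x = x)"
proof -
  interpret banach_over s by fact
  have K: "K * norm x \<ge> 0" for x :: 'x using P(3)[of 1 x] norm_ge_zero[of "P 1 x"] by linarith
  obtain f y where fy: "\<And>b. b \<in> B \<Longrightarrow> f b \<in> dual s" "\<And>b. b \<in> B \<Longrightarrow> y b \<in> span B"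
    "\<And>x. x \<in> span B \<Longrightarrow> (\<Sum>b\<in>B. s (f b x) (y b)) = x"
    using finite_dim_projection[OF assms(1) \<open>finite B\<close>] by blast
  define R where "R x = (\<Sum>b\<in>B. s (f b x) (y b))" for x
  have R: "operator s s R" unfolding R_def using operator_finite_sum[OF assms(1) \<open>finite B\<close> fy(1)] .
  have "R x \<in> span B" for x unfolding R_def by (intro span_sum span_scale fy(2))
  then have "bounded_finite_rank s R" using bounded_finite_rankI[OF assms(1) R \<open>finite B\<close>] by blast
  moreover have Pop: "operator s s (P n)" if "n \<ge> 1" for n
    using P(1)[OF that] by (rule bounded_finite_rankE)
  ultimately have "\<exists>n\<ge>1. \<forall>x. norm (R x - P n (R x)) \<le> 1 / 2 * norm x"
    using pointwise_limit_uniform_on_finite_rank[OF assms(1) _ Pop lim, of R "1/2"] by simp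
  then obtain n where n: "n \<ge> 1" "\<And>x. norm (R x - P n (R x)) \<le> 1 / 2 * norm x" by blast
  define A where "A x = R x - P n (R x)" for x
  have A: "operator s s A" unfolding A_def
    by (intro operator_diff[OF assms(1,1)] R operator_compose[OF Pop[OF n(1)] R])
  have small: "norm (A x) \<le> norm x / 2" for x using n(2)[of x] by (simp add: A_def)
  obtain J where J: "operator s s J" "\<And>x. J (x - A x) = x" "\<And>y. J y - A (J y) = y"
    "\<And>y. norm (J y) \<le> 2 * norm y"
    using near_identity_invertible[OF assms(1) A small] by blast
  define P' where "P' x = J (P n (x - A x))" for x
  have "bounded_finite_rank s P'" unfolding P'_def
    by (rule bounded_finite_rank_compose[OF assms(1)
          operator_diff[OF assms(1,1) operator_ident[OF assms(1)] A] P(1)[OF n(1)] J(1)])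
  moreover have "P' (P' x) = P' x" for x unfolding P'_def by (simp add: J(3) P(2)[OF n(1)])
  moreover have "norm (P' x) \<le> 4 * K * norm x" for x
  proof -
    have *: "norm (x - A x) \<le> 2 * norm x" using norm_triangle_ineq4[of x "A x"] small[of x] norm_ge_zero[of x] by linarith
    have "norm (P' x) \<le> 2 * (K * norm (x - A x))"
      unfolding P'_def using J(4)[of "P n (x - A x)"] P(3)[OF n(1), of "x - A x"] by simp
    also have "\<dots> \<le> 2 * (K * (2 * norm x))"
    proof (cases "x = 0")
      case False
      then have "K \<ge> 0" using K[of x] by (simp add: zero_le_mult_iff)
      then show ?thesis using * by (intro mult_left_mono) auto
    qed (use * in auto)
    finally show ?thesis by simp
  qed
  moreover have "P' x = x" if "x \<in> span B" for x
  proof -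
    have "x - A x = P n x" using fy(3)[OF that] by (simp add: A_def R_def)
    then show ?thesis unfolding P'_def using J(2)[of x] P(2)[OF n(1)] by simp
  qed
  ultimately show ?thesis by blast
qed

lemma convex_hull_finite_rank:
  assumes "banach_over s"
    and A: "\<And>T. T \<in> A \<Longrightarrow> bounded_finite_rank s (blinfun_apply T)" "\<And>T. T \<in> A \<Longrightarrow> norm T \<le> K"
    and T: "T \<in> convex hull A"
  shows "bounded_finite_rank s (blinfun_apply T) \<and> norm T \<le> K"
proof -
  interpret banach_over s by fact
  have "convex {T. bounded_finite_rank s (blinfun_apply T)}"
  proof (rule convexI, clarify)
    fix S T and u v :: real
    assume S: "bounded_finite_rank s (blinfun_apply S)" and T: "bounded_finite_rank s (blinfun_apply T)"
    obtain B where B: "operator s s (blinfun_apply S)" "finite B" "range (blinfun_apply S) = span B"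
      using S by (rule bounded_finite_rankE)
    obtain C where C: "operator s s (blinfun_apply T)" "finite C" "range (blinfun_apply T) = span C"
      using T by (rule bounded_finite_rankE)
    have eq: "blinfun_apply (u *\<^sub>R S + v *\<^sub>R T) x = s (of_real u) (S x) + s (of_real v) (T x)" for x
      by (simp add: blinfun.add_left blinfun.scaleR_left scale_of_real)
    have "operator s s (blinfun_apply (u *\<^sub>R S + v *\<^sub>R T))"
      by (rule operatorI[OF assms(1,1) _ _ norm_blinfun])
        (simp_all add: blinfun.add_right eq operatorD(4)[OF B(1)] operatorD(4)[OF C(1)]
          scale_right_distrib mult.commute)
    moreover have "blinfun_apply (u *\<^sub>R S + v *\<^sub>R T) x \<in> span (B \<union> C)" for x
      unfolding eq using B(3) C(3) span_mono[of B "B \<union> C"] span_mono[of C "B \<union> C"]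
      by (intro span_add span_scale) blast+
    ultimately show "bounded_finite_rank s (blinfun_apply (u *\<^sub>R S + v *\<^sub>R T))"
      using B(2) C(2) by (intro bounded_finite_rankI[OF assms(1), of _ "B \<union> C"]) auto
  qed
  then have "convex hull A \<subseteq> {T. bounded_finite_rank s (blinfun_apply T)}"
    using A(1) by (intro hull_minimal) auto
  moreover have "convex hull A \<subseteq> cball 0 K"
    using A(2) by (intro hull_minimal) auto
  ultimately show ?thesis using T by auto
qed

text \<open>
  The inductive step of the construction of a decomposition. The bound on \<open>W\<close> involves only \<open>K\<close>, which
  is what allows the step to be iterated.
\<close>

lemma extend_projection:
  fixes s :: "'k::real_or_complex \<Rightarrow> 'x::banach \<Rightarrow> 'x"
  assumes "banach_over s" "reflexive_space s"
    and P: "\<And>n. n \<ge> 1 \<Longrightarrow> bounded_finite_rank s (P n)" "\<And>n x. n \<ge> 1 \<Longrightarrow> P n (P n x) = P n x"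
      "\<And>n x. n \<ge> 1 \<Longrightarrow> norm (P n x) \<le> K * norm x"
    and "0 \<le> K" and lim: "\<And>x. (\<lambda>n::nat. P n x) \<longlonglongrightarrow> x"
    and Q: "bounded_finite_rank s Q" "\<And>x. Q (Q x) = Q x"
  shows "\<exists>W. bounded_finite_rank s W \<and> (\<forall>x. W (W x) = W x) \<and>
    (\<forall>x. norm (W x) \<le> (4 * K + (K + 1) + (K + 1) * (4 * K)) * norm x) \<and>
    (\<forall>x. Q (W x) = Q x) \<and> (\<forall>x. W (Q x) = Q x) \<and> W x0 = x0"
proof -
  interpret banach_over s by fact
  have Pop: "operator s s (P n)" if "n \<ge> 1" for n
    using P(1)[OF that] by (rule bounded_finite_rankE)
  have Pn: "blinfun_apply (Blinfun (P n)) = P n" if "n \<ge> 1" for n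
    using operatorD(5)[OF Pop[OF that]] by (simp add: bounded_linear_Blinfun_apply)
  obtain T0 where T0: "T0 \<in> convex hull ((\<lambda>n. Blinfun (P n)) ` {1..})"
    "\<And>x. norm (Q (blinfun_apply T0 x) - Q x) \<le> 1 * norm x"
    using convex_combination_approximates_from_left[OF assms(1,2) Q(1) Pop lim, of 1] by auto
  have "bounded_finite_rank s (blinfun_apply T0) \<and> norm T0 \<le> K"
  proof (rule convex_hull_finite_rank[OF assms(1) _ _ T0(1)])
    show "norm T \<le> K" if "T \<in> (\<lambda>n. Blinfun (P n)) ` {1..}" for T
      using that P(3) \<open>0 \<le> K\<close> by (auto intro!: norm_blinfun_bound simp: Pn)
  qed (use P(1) Pn in auto)
  then have T0_rank: "bounded_finite_rank s (blinfun_apply T0)"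
    and T0_norm: "norm (blinfun_apply T0 x) \<le> K * norm x" for x
    using norm_blinfun[of T0 x] mult_right_mono[of "norm T0" K "norm x"] by auto
  obtain C where C: "operator s s (blinfun_apply T0)" "finite C" "range (blinfun_apply T0) = span C"
    using T0_rank by (rule bounded_finite_rankE)
  obtain D where D: "operator s s Q" "finite D" "range Q = span D"
    using Q(1) by (rule bounded_finite_rankE)
  \<comment> \<open>The correction has norm at most 1 and takes its values in the range of \<open>Q\<close>, where \<open>Q\<close> is the
    identity; hence it makes \<open>Q T = Q\<close> exact.\<close>
  define T where "T x = blinfun_apply T0 x + (Q x - Q (blinfun_apply T0 x))" for x
  have T: "operator s s T" unfolding T_def
    by (intro operator_add operator_diff assms(1) C(1) D(1) operator_compose[OF D(1) C(1)])
  note Top = operatorD[OF T] and Qop = operatorD[OF D(1)]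
  have QT: "Q (T x) = Q x" for x by (simp add: T_def Qop Q(2))
  have T_norm: "norm (T x) \<le> (K + 1) * norm x" for x
  proof -
    have "norm (T x) \<le> norm (blinfun_apply T0 x) + norm (Q x - Q (blinfun_apply T0 x))"
      unfolding T_def by (rule norm_triangle_ineq)
    also have "\<dots> \<le> K * norm x + 1 * norm x"
      using T0_norm T0(2)[of x] by (intro add_mono) (auto simp: norm_minus_commute)
    finally show ?thesis by (simp add: distrib_right)
  qed
  define E where "E = insert x0 (C \<union> D)"
  have E: "finite E" using C(2) D(2) by (simp add: E_def)
  have subE: "span C \<subseteq> span E" "span D \<subseteq> span E" by (auto intro!: span_mono simp: E_def)
  have Q_E: "Q x \<in> span E" for x using D(3) subE(2) by blast
  have T_E: "T x \<in> span E" for x unfolding T_def using C(3) subE Q_E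
    by (intro span_add span_diff) auto
  have x0_E: "x0 \<in> span E" by (intro span_base) (simp add: E_def)
  obtain P' where P': "bounded_finite_rank s P'" "\<And>x. P' (P' x) = P' x" "\<And>x. norm (P' x) \<le> 4 * K * norm x"
    "\<And>x. x \<in> span E \<Longrightarrow> P' x = x"
    using projection_containing_finite_dim[OF assms(1) P lim E] by blast
  obtain F where F: "operator s s P'" "finite F" "range P' = span F"
    using P'(1) by (rule bounded_finite_rankE)
  note P'op = operatorD[OF F(1)]
  \<comment> \<open>That is, \<open>1 - W = (1 - T) (1 - P')\<close>.\<close>
  define W where "W x = P' x + T x - T (P' x)" for x
  have "operator s s W" unfolding W_def
    by (intro operator_add operator_diff assms(1) T F(1) operator_compose[OF T F(1)])
  moreover have "W x \<in> span (F \<union> E)" for x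
    unfolding W_def using F(3) T_E span_mono[of F "F \<union> E"] span_mono[of E "F \<union> E"]
    by (intro span_add span_diff) blast+
  ultimately have "bounded_finite_rank s W"
    using F(2) E by (intro bounded_finite_rankI[OF assms(1), of _ "F \<union> E"]) auto
  moreover have "W (W x) = W x" for x
  proof -
    have "P' (W x) = W x" by (simp add: W_def P'op P'(2) P'(4)[OF T_E])
    then show ?thesis unfolding W_def[of "W x"] by simp
  qed
  moreover have "norm (W x) \<le> (4 * K + (K + 1) + (K + 1) * (4 * K)) * norm x" for x
  proof -
    have "norm (W x) \<le> norm (P' x) + norm (T x) + norm (T (P' x))"
      unfolding W_def by (rule order_trans[OF norm_triangle_ineq4]) (simp add: norm_triangle_ineq)
    also have "\<dots> \<le> 4 * K * norm x + (K + 1) * norm x + (K + 1) * (4 * K * norm x)"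
      using order_trans[OF T_norm[of "P' x"] mult_left_mono[OF P'(3)[of x], of "K + 1"]] \<open>0 \<le> K\<close>
      by (intro add_mono P'(3) T_norm) auto
    finally show ?thesis by (simp add: algebra_simps)
  qed
  moreover have "Q (W x) = Q x" for x by (simp add: W_def Qop QT)
  moreover have "W (Q x) = Q x" for x by (simp add: W_def P'(4)[OF Q_E])
  moreover have "W x0 = x0" by (simp add: W_def P'(4)[OF x0_E])
  ultimately show ?thesis by blast
qed

section \<open>From approximating projections to a decomposition\<close>

lemma approximating_projections_bounded:
  assumes "approximating_projections s P"
  obtains K where "0 \<le> K" "\<And>n x. n \<ge> 1 \<Longrightarrow> norm (P n x) \<le> K * norm x"
proof -
  have lim: "(\<lambda>n. P n x) \<longlonglongrightarrow> x" and bl: "n \<ge> 1 \<Longrightarrow> bounded_linear (P n)" for n x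
    using assms by (auto simp: approximating_projections_def bounded_finite_rank_def)
  have "\<exists>M. \<forall>T\<in>P ` {1..}. norm (T x) \<le> M" for x
  proof -
    have "Bseq (\<lambda>n. P n x)" using lim by (intro convergent_imp_Bseq convergentI)
    then show ?thesis by (auto simp: Bseq_def)
  qed
  then have "\<exists>M\<ge>0. \<forall>T\<in>P ` {1..}. \<forall>x. norm (T x) \<le> M * norm x"
    using bl by (intro uniform_boundedness) auto
  then show thesis using that by auto
qed

text \<open>
  Starting from the zero operator, \<open>extend_projection\<close> yields a nested sequence of uniformly bounded
  projections whose \<open>n\<close>-th step fixes the \<open>n\<close>-th member of a dense sequence. By nesting, all later
  projections fix it as well, so the sequence converges on a dense set and therefore everywhere.
\<close>

theorem finite_dimensional_decomposition_if_reflexive: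
  fixes s :: "'k::real_or_complex \<Rightarrow> 'x::banach \<Rightarrow> 'x"
  assumes "banach_over s" "reflexive_space s" and sep: "separable_space (euclidean :: 'x topology)"
    and "bounded_projection_approximation_property s"
  shows "finite_dimensional_decomposition s"
proof -
  interpret banach_over s by fact
  obtain P where P: "approximating_projections s P"
    using assms(4) unfolding bounded_projection_approximation_property_def by blast
  then have P_rank: "\<And>n. n \<ge> 1 \<Longrightarrow> bounded_finite_rank s (P n)"
    and P_idem: "\<And>n x. n \<ge> 1 \<Longrightarrow> P n (P n x) = P n x" and lim: "\<And>x. (\<lambda>n. P n x) \<longlonglongrightarrow> x"
    by (auto simp: approximating_projections_def fun_eq_iff)
  obtain K where K: "0 \<le> K" "\<And>n x. n \<ge> 1 \<Longrightarrow> norm (P n x) \<le> K * norm x"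
    using approximating_projections_bounded[OF P] by blast
  define l where "l = 4 * K + (K + 1) + (K + 1) * (4 * K)"
  have l: "l \<ge> 0" unfolding l_def using K(1) by simp
  obtain C :: "'x set" where C: "countable C" "closure C = UNIV"
    using sep by (auto simp: separable_space_def)
  define d where "d = from_nat_into C"
  have "C \<noteq> {}" using C(2) by auto
  then have range_d: "range d = C" unfolding d_def by (intro range_from_nat_into C(1))
  define good where "good W \<longleftrightarrow> bounded_finite_rank s W \<and> (\<forall>x. W (W x) = W x) \<and>
    (\<forall>x. norm (W x) \<le> l * norm x)" for W :: "'x \<Rightarrow> 'x"
  have "\<exists>W. \<forall>n. good (W n) \<and> ((\<forall>x. W n (W (Suc n) x) = W n x) \<and> (\<forall>x. W (Suc n) (W n x) = W n x) \<and>
      W (Suc n) (d n) = d n)"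
  proof (rule dependent_nat_choice)
    have "operator s s (\<lambda>x. 0)" by (rule operatorI[OF assms(1,1), where K=0]) auto
    then have "bounded_finite_rank s (\<lambda>x. 0)"
      by (rule bounded_finite_rankI[OF assms(1), where B="{}"]) auto
    then show "\<exists>W. good W" using l by (intro exI[of _ "\<lambda>x. 0"]) (simp add: good_def)
  next
    fix W n assume "good W"
    then show "\<exists>W'. good W' \<and> ((\<forall>x. W (W' x) = W x) \<and> (\<forall>x. W' (W x) = W x) \<and> W' (d n) = d n)"
      using extend_projection[OF assms(1,2) P_rank P_idem K(2,1) lim, of W "d n"]
      unfolding good_def l_def by blast
  qed
  then obtain W where W: "\<And>n. good (W n)" "\<And>n x. W n (W (Suc n) x) = W n x"
    "\<And>n x. W (Suc n) (W n x) = W n x" "\<And>n. W (Suc n) (d n) = d n" by blast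
  have nested: "W m (W n x) = W m x \<and> W n (W m x) = W m x" if "m \<le> n" for m n x
    using that
  proof (induction n arbitrary: x rule: dec_induct)
    case base
    then show ?case using W(1)[of m] by (simp add: good_def)
  next
    case (step n)
    then show ?case by (metis W(2,3))
  qed
  have fixed: "W n (d j) = d j" if "j < n" for n j
    using nested[of "Suc j" n "d j"] W(4)[of j] that by simp
  have W_lim: "(\<lambda>n. W n x) \<longlonglongrightarrow> x" for x
  proof (rule LIMSEQ_I)
    fix e :: real assume "e > 0"
    then have "0 < e / (l + 1)" using l by simp
    then obtain c where "c \<in> C" and c: "dist c x < e / (l + 1)"
      using C(2) closure_approachable[of x C] by blast
    then obtain j where j: "c = d j" using range_d by blast
    have "norm (W n x - x) < e" if n: "n \<ge> Suc j" for n
    proof -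
      have "bounded_linear (W n)" using W(1)[of n] by (simp add: good_def bounded_finite_rank_def)
      then have "W n x - x = W n (x - c) - (x - c)"
        using fixed[of j n] n by (simp add: j linear_simps)
      then have "norm (W n x - x) \<le> norm (W n (x - c)) + norm (x - c)"
        by (metis norm_triangle_ineq4)
      also have "\<dots> \<le> l * norm (x - c) + norm (x - c)" using W(1)[of n] by (simp add: good_def)
      also have "\<dots> = (l + 1) * dist c x" by (simp add: dist_norm norm_minus_commute algebra_simps)
      also have "\<dots> < e" using c l by (simp add: field_simps)
      finally show ?thesis .
    qed
    then show "\<exists>N. \<forall>n\<ge>N. norm (W n x - x) < e" by blast
  qed
  have "approximating_projections s W"
    unfolding approximating_projections_def using W(1) W_lim by (auto simp: good_def fun_eq_iff)
  then show ?thesis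
    unfolding finite_dimensional_decomposition_def
    using nested by (intro exI[of _ W]) (auto simp: fun_eq_iff)
qed

section \<open>The form identifies the second space with the dual of the first\<close>

lemma sesquilinearD:
  assumes "sesquilinear sU sV a"
  shows "a (u + u') v = a u v + a u' v" "a (sU c u) v = c * a u v"
    "a u (v + v') = a u v + a u v'" "a u (sV c v) = conjg c * a u v"
  using assms by (auto simp: sesquilinear_def antilinear_def Vector_Spaces.linear_iff)

locale well_posed_form =
  fixes sU :: "'k::real_or_complex \<Rightarrow> 'u::banach \<Rightarrow> 'u"
    and sV :: "'k \<Rightarrow> 'v::banach \<Rightarrow> 'v"
    and a :: "'u \<Rightarrow> 'v \<Rightarrow> 'k"
  assumes U: "banach_over sU" and V: "banach_over sV"
    and reflexive: "reflexive_space sU"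
    and sesquilinear: "sesquilinear sU sV a" and continuous: "continuous_form a"
    and well_posed: "\<forall>L\<in>antidual sV. \<exists>!u. \<forall>v. a u v = L v"
begin

sublocale U: banach_over sU by (rule U)
sublocale V: banach_over sV by (rule V)

lemmas form_simps = sesquilinearD[OF sesquilinear]

lemma form_bound: "\<exists>M>0. \<forall>u v. norm (a u v) \<le> M * norm u * norm v"
  using continuous by (simp add: continuous_form_def)

lemma bounded_linear_form_left: "bounded_linear (\<lambda>u. a u v)"
proof -
  obtain M where "\<And>u v. norm (a u v) \<le> M * norm u * norm v" using form_bound by blast
  then show ?thesis
    by (intro bounded_linear_intro[where K="M * norm v"])
      (auto simp: form_simps mult_ac scaleR_conv_of_real simp flip: U.scale_of_real)
qed

lemma bounded_linear_form_right: "bounded_linear (a u)"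
proof -
  obtain M where "\<And>u v. norm (a u v) \<le> M * norm u * norm v" using form_bound by blast
  then show ?thesis
    by (intro bounded_linear_intro[where K="M * norm u"])
      (auto simp: form_simps mult_ac scaleR_conv_of_real conjg_of_real simp flip: V.scale_of_real)
qed

lemma form_left_dual: "(\<lambda>u. a u v) \<in> dual sU"
  using bounded_linear_norm_le[OF bounded_linear_form_left[of v]]
  by (auto intro: dualI[OF U] simp: form_simps)

lemma form_right_antidual: "a u \<in> antidual sV"
  using linear_continuous_on[OF bounded_linear_form_right]
  by (simp add: antidual_def antilinear_def form_simps)

lemma form_left_inject: "(\<And>v. a u v = a u' v) \<Longrightarrow> u = u'"
  using well_posed form_right_antidual[of u] by (metis (no_types))

lemma dual_eq_conjg_form: "g \<in> dual sV \<Longrightarrow> \<exists>u. \<forall>v. conjg (g v) = a u v"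
  using well_posed conjg_dual[OF V] by metis

lemma form_right_inject:
  assumes "\<And>u. a u v = a u v'"
  shows "v = v'"
proof (rule ccontr)
  assume "v \<noteq> v'"
  then obtain g where g: "g \<in> dual sV" "g (v - v') = 1"
    using dual_separates_zero[OF V, of "v - v'"] by auto
  obtain u where u: "\<And>w. conjg (g w) = a u w" using dual_eq_conjg_form[OF g(1)] by blast
  have "a u (v - v') = 0" using assms[of u] linear_simps(2)[OF bounded_linear_form_right] by simp
  then have "conjg 1 = (0 :: 'k)" using u[of "v - v'"] g(2) by simp
  then show False using norm_conjg[of "1 :: 'k"] by simp
qed

text \<open>
  Every functional on \<open>V\<close> is of the form \<open>a(u,\<cdot>)\<close> up to conjugation, so the vectors \<open>v\<close> for which
  \<open>a(\<cdot>,v)\<close> has norm at most one are weakly bounded. They are thus norm bounded, by uniform boundedness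
  of the evaluations \<open>f \<mapsto> f v\<close> on the Banach space of real functionals.
\<close>

lemma inf_sup: "\<exists>C\<ge>0. \<forall>v e. 0 < e \<longrightarrow> (\<forall>u. norm (a u v) \<le> e * norm u) \<longrightarrow> norm v \<le> C * e"
proof -
  define G where "G = {v. \<forall>u. norm (a u v) \<le> norm u}"
  have "\<exists>M\<ge>0. \<forall>T\<in>(\<lambda>v f. blinfun_apply f v) ` G. \<forall>f::'v \<Rightarrow>\<^sub>L real. norm (T f) \<le> M * norm f"
  proof (rule uniform_boundedness)
    show "bounded_linear T" if "T \<in> (\<lambda>v f. blinfun_apply f v) ` G" for T :: "('v \<Rightarrow>\<^sub>L real) \<Rightarrow> real"
      using that by (auto intro: blinfun.bounded_linear_left)
  next
    fix f :: "'v \<Rightarrow>\<^sub>L real"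
    obtain F where F: "F \<in> dual sV" "\<And>v. re (F v) = blinfun_apply f v"
      using dual_of_real_functional[OF V blinfun.bounded_linear_right[of f]] by blast
    obtain u where u: "\<And>v. conjg (F v) = a u v" using dual_eq_conjg_form[OF F(1)] by blast
    have "\<bar>blinfun_apply f v\<bar> \<le> norm u" if "v \<in> G" for v
    proof -
      have "\<bar>blinfun_apply f v\<bar> \<le> norm (F v)" using abs_re_le[of "F v"] F(2)[of v] by simp
      also have "\<dots> = norm (a u v)" using norm_conjg[of "F v"] by (simp add: u)
      also have "\<dots> \<le> norm u" using that by (simp add: G_def)
      finally show ?thesis .
    qed
    then show "\<exists>M. \<forall>T\<in>(\<lambda>v f. blinfun_apply f v) ` G. norm (T f) \<le> M" by auto
  qed
  then obtain M where M: "M \<ge> 0" "\<And>v (f :: 'v \<Rightarrow>\<^sub>L real). v \<in> G \<Longrightarrow> \<bar>blinfun_apply f v\<bar> \<le> M * norm f"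
    by auto
  have G_bound: "norm v \<le> M" if "v \<in> G" for v
  proof -
    obtain f where f: "bounded_linear f" "\<And>w. \<bar>f w\<bar> \<le> norm w" "f v = norm v"
      using norming_functional by blast
    have "norm (Blinfun f) \<le> 1"
      using f(1,2) by (intro norm_blinfun_bound) (auto simp: bounded_linear_Blinfun_apply)
    then have "M * norm (Blinfun f) \<le> M" using M(1) by (simp add: mult_left_le)
    then show ?thesis using M(2)[OF that, of "Blinfun f"] f by (simp add: bounded_linear_Blinfun_apply)
  qed
  have "norm v \<le> M * e" if e: "0 < e" and small: "\<And>u. norm (a u v) \<le> e * norm u" for v e
  proof -
    have "norm (a u ((1 / e) *\<^sub>R v)) \<le> norm u" for u
      using small[of u] e linear_simps(5)[OF bounded_linear_form_right] by (simp add: field_simps)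
    then have "norm ((1 / e) *\<^sub>R v) \<le> M" by (intro G_bound) (simp add: G_def)
    then show ?thesis using e by (simp add: field_simps)
  qed
  then show ?thesis using M(1) by blast
qed

text \<open>
  Otherwise a functional on the dual would separate \<open>f\<close> from all \<open>a(\<cdot>,v)\<close>. By reflexivity it is
  evaluation at some \<open>x\<close>, up to taking real parts. Being bounded below on a subspace, it vanishes there:
  \<open>a(x,v) = 0\<close> for all \<open>v\<close>. So \<open>x = 0\<close>, which cannot separate anything.
\<close>

lemma forms_dense_in_dual:
  assumes "f \<in> dual sU" "e > 0"
  shows "\<exists>v. \<forall>u. norm (a u v - f u) \<le> e * norm u"
proof (rule ccontr)
  assume none: "\<not> ?thesis"
  note D = dualD[OF U]
  define j where "j v = Blinfun (\<lambda>u. a u v)" for v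
  have j: "blinfun_apply (j v) = (\<lambda>u. a u v)" for v
    unfolding j_def by (rule bounded_linear_Blinfun_apply[OF bounded_linear_form_left])
  have B: "blinfun_apply (Blinfun g) = g" if "g \<in> dual sU" for g
    by (rule bounded_linear_Blinfun_apply[OF D(5)[OF that]])
  have "linear j"
    by (rule linearI; rule blinfun_eqI)
      (simp_all add: j blinfun.add_left blinfun.scaleR_left linear_simps[OF bounded_linear_form_right])
  then have conv: "convex (range j)" by (intro convex_linear_image) auto
  have far: "e \<le> norm (c - Blinfun f)" if "c \<in> range j" for c
  proof (rule ccontr)
    assume "\<not> e \<le> norm (c - Blinfun f)"
    then have less: "norm (c - Blinfun f) < e" by simp
    from that obtain v where v: "c = j v" by blast
    have "norm (a u v - f u) \<le> e * norm u" for u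
    proof -
      have "norm (a u v - f u) = norm (blinfun_apply (c - Blinfun f) u)"
        by (simp add: v j B[OF assms(1)] blinfun.diff_left)
      also have "\<dots> \<le> norm (c - Blinfun f) * norm u" by (rule norm_blinfun)
      also have "\<dots> \<le> e * norm u" using less by (intro mult_right_mono) auto
      finally show ?thesis .
    qed
    then show False using none by blast
  qed
  have "range j \<noteq> {}" by blast
  then have "\<exists>\<Phi>. bounded_linear \<Phi> \<and> (\<forall>A. \<bar>\<Phi> A\<bar> \<le> norm A) \<and> (\<forall>c\<in>range j. \<Phi> (Blinfun f) + e \<le> \<Phi> c)"
    by (rule convex_separation[OF conv _ far less_imp_le[OF assms(2)]])
  then obtain \<Phi> where \<Phi>: "bounded_linear \<Phi>" "\<And>A. \<bar>\<Phi> A\<bar> \<le> norm A" "\<And>v. \<Phi> (Blinfun f) + e \<le> \<Phi> (j v)"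
    by blast
  interpret \<Phi>: bounded_linear \<Phi> by fact
  have "\<exists>x. \<forall>g\<in>dual sU. \<Phi> (Blinfun g) = re (g x)"
  proof (rule reflexive_space_real_functional[OF U reflexive, where K=1])
    fix g h assume gh: "g \<in> dual sU" "h \<in> dual sU"
    have "Blinfun (\<lambda>x. g x + h x) = Blinfun g + Blinfun h"
      using bounded_linear_add[OF D(5)[OF gh(1)] D(5)[OF gh(2)]]
      by (intro blinfun_eqI) (simp add: B gh blinfun.add_left bounded_linear_Blinfun_apply)
    then show "\<Phi> (Blinfun (\<lambda>x. g x + h x)) = \<Phi> (Blinfun g) + \<Phi> (Blinfun h)" by (simp add: \<Phi>.add)
  next
    fix c g assume g: "g \<in> dual sU"
    have "Blinfun (\<lambda>x. of_real c * g x) = c *\<^sub>R Blinfun g"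
      using bounded_linear_compose[OF bounded_linear_mult_right D(5)[OF g]]
      by (intro blinfun_eqI) (simp add: B g blinfun.scaleR_left bounded_linear_Blinfun_apply scaleR_conv_of_real)
    then show "\<Phi> (Blinfun (\<lambda>x. of_real c * g x)) = c * \<Phi> (Blinfun g)" by (simp add: \<Phi>.scaleR)
  next
    fix g assume g: "g \<in> dual sU"
    show "\<bar>\<Phi> (Blinfun g)\<bar> \<le> 1 * onorm g" using \<Phi>(2)[of "Blinfun g"] by (simp add: norm_blinfun.rep_eq B g)
  qed
  then obtain x where x: "\<And>g. g \<in> dual sU \<Longrightarrow> \<Phi> (Blinfun g) = re (g x)" by blast
  have ge: "re (f x) + e \<le> re (a x v)" for v
    using \<Phi>(3)[of v] x[OF assms(1)] x[OF form_left_dual[of v]] by (simp add: j_def)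
  have "a x v = 0" for v
  proof (rule ccontr)
    assume nz: "a x v \<noteq> 0"
    \<comment> \<open>The scaling factor is chosen such that the value at the multiple of \<open>v\<close> equals \<open>re (f x)\<close>.\<close>
    define t where "t = re (f x) / (norm (a x v))\<^sup>2"
    have "a x (sV (of_real t * a x v) v) = t *\<^sub>R (conjg (a x v) * a x v)"
      by (simp add: form_simps conjg_mult conjg_of_real scaleR_conv_of_real mult.assoc)
    then have "re (a x (sV (of_real t * a x v) v)) = re (f x)"
      using nz by (simp add: re_scaleR re_conjg_mult_self t_def)
    then show False using ge[of "sV (of_real t * a x v) v"] assms(2) by simp
  qed
  then have "x = 0" using linear_simps(3)[OF bounded_linear_form_left] by (intro form_left_inject) simp
  then show False
    using ge[of 0] assms(2) D(3)[OF assms(1)] linear_simps(3)[OF bounded_linear_form_right] by simp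
qed

text \<open>
  The approximants from \<open>forms_dense_in_dual\<close> form a Cauchy sequence by the inf-sup inequality.
\<close>

lemma dual_eq_form:
  assumes f: "f \<in> dual sU"
  shows "\<exists>v. \<forall>u. f u = a u v"
proof -
  have "\<exists>v. \<forall>u. norm (a u v - f u) \<le> inverse (real (Suc n)) * norm u" for n
    by (rule forms_dense_in_dual[OF f]) simp
  then obtain w where w: "\<And>n u. norm (a u (w n) - f u) \<le> inverse (real (Suc n)) * norm u" by metis
  obtain C where C: "C \<ge> 0" "\<And>v e. 0 < e \<Longrightarrow> (\<And>u. norm (a u v) \<le> e * norm u) \<Longrightarrow> norm v \<le> C * e"
    using inf_sup by blast
  have close: "norm (w m - w n) \<le> C * (inverse (real (Suc m)) + inverse (real (Suc n)))" for m n
  proof (rule C(2))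
    fix u
    have "a u (w m - w n) = (a u (w m) - f u) - (a u (w n) - f u)"
      by (simp add: linear_simps[OF bounded_linear_form_right])
    then have "norm (a u (w m - w n)) \<le> norm (a u (w m) - f u) + norm (a u (w n) - f u)"
      by (metis norm_triangle_ineq4)
    then show "norm (a u (w m - w n)) \<le> (inverse (real (Suc m)) + inverse (real (Suc n))) * norm u"
      using w[of u m] w[of u n] by (simp add: distrib_right)
  qed (simp add: add_pos_pos)
  have "Cauchy w"
  proof (rule CauchyI)
    fix e :: real assume e: "e > 0"
    then obtain N where N: "inverse (real (Suc N)) < e / (2 * C + 1)"
      using reals_Archimedean[of "e / (2 * C + 1)"] C(1) by auto
    have "norm (w m - w n) < e" if mn: "m \<ge> N" "n \<ge> N" for m n
    proof -
      have "inverse (real (Suc m)) \<le> inverse (real (Suc N))" "inverse (real (Suc n)) \<le> inverse (real (Suc N))"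
        using mn by (auto intro!: le_imp_inverse_le)
      then have "C * (inverse (real (Suc m)) + inverse (real (Suc n))) \<le> C * (2 * inverse (real (Suc N)))"
        using C(1) by (intro mult_left_mono) linarith+
      then have "norm (w m - w n) \<le> C * (2 * inverse (real (Suc N)))"
        using close[of m n] by linarith
      also have "\<dots> \<le> (2 * C + 1) * inverse (real (Suc N))" by (simp add: algebra_simps)
      also have "\<dots> < e" using N C(1) by (simp add: field_simps)
      finally show ?thesis .
    qed
    then show "\<exists>M. \<forall>m\<ge>M. \<forall>n\<ge>M. norm (w m - w n) < e" by blast
  qed
  then obtain v where v: "w \<longlonglongrightarrow> v" using Cauchy_convergent convergent_def by blast
  have "f u = a u v" for u
  proof (rule LIMSEQ_unique)
    show "(\<lambda>n. a u (w n)) \<longlonglongrightarrow> a u v" by (rule bounded_linear.tendsto[OF bounded_linear_form_right v])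
    have "(\<lambda>n. inverse (real (Suc n)) * norm u) \<longlonglongrightarrow> 0"
      using tendsto_mult_left_zero[OF LIMSEQ_inverse_real_of_nat] by blast
    then have "(\<lambda>n. a u (w n) - f u) \<longlonglongrightarrow> 0"
      by (rule Lim_null_comparison[rotated]) (use w in simp)
    then show "(\<lambda>n. a u (w n)) \<longlonglongrightarrow> f u" by (simp add: LIM_zero_iff)
  qed
  then show ?thesis by blast
qed

section \<open>Adjoint operators with respect to the form\<close>

lemma adjoint_exists:
  assumes T: "operator sU sU T"
  shows "\<exists>T'. operator sV sV T' \<and> (\<forall>u v. a (T u) v = a u (T' v))"
proof -
  have "\<exists>w. \<forall>u. a (T u) v = a u w" for v
    using dual_eq_form[OF dual_compose[OF U U form_left_dual T]] .
  then obtain T' where T': "\<And>u v. a (T u) v = a u (T' v)" by metis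
  obtain K where K: "K \<ge> 0" "\<And>u. norm (T u) \<le> K * norm u"
    using bounded_linear_norm_le[OF operatorD(5)[OF T]] by blast
  obtain M where M: "M > 0" "\<And>u v. norm (a u v) \<le> M * norm u * norm v" using form_bound by blast
  obtain C where C: "C \<ge> 0" "\<And>v e. 0 < e \<Longrightarrow> (\<And>u. norm (a u v) \<le> e * norm u) \<Longrightarrow> norm v \<le> C * e"
    using inf_sup by blast
  have "operator sV sV T'"
  proof (rule operatorI[OF V V, where K="C * (M * K + 1)"])
    show "T' (x + y) = T' x + T' y" for x y
      by (rule form_right_inject) (simp add: form_simps flip: T')
    show "T' (sV c x) = sV c (T' x)" for c x
      by (rule form_right_inject) (simp add: form_simps flip: T')
    show "norm (T' v) \<le> C * (M * K + 1) * norm v" for v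
    proof (cases "v = 0")
      case True
      have "T' v = 0"
        by (rule form_right_inject) (simp add: True linear_simps(3)[OF bounded_linear_form_right] flip: T')
      then show ?thesis by (simp add: True)
    next
      case False
      have "norm (T' v) \<le> C * ((M * K + 1) * norm v)"
      proof (rule C(2))
        show "0 < (M * K + 1) * norm v" using False M(1) K(1) by (simp add: add_nonneg_pos)
        fix u
        have "norm (a u (T' v)) \<le> M * norm (T u) * norm v" using M(2)[of "T u" v] by (simp add: T')
        also have "\<dots> \<le> M * (K * norm u) * norm v"
          using K(2)[of u] M(1) by (intro mult_right_mono mult_left_mono) auto
        also have "\<dots> \<le> (M * K + 1) * norm v * norm u" by (simp add: algebra_simps)
        finally show "norm (a u (T' v)) \<le> (M * K + 1) * norm v * norm u" .
      qed
      then show ?thesis by (simp add: mult.assoc)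
    qed
  qed
  then show ?thesis using T' by blast
qed

text \<open>
  A representation \<open>T u = \<Sum> f\<^sub>b(u) y\<^sub>b\<close> with \<open>f\<^sub>b = a(\<cdot>,w\<^sub>b)\<close> shows that the range of the adjoint is
  spanned by the \<open>w\<^sub>b\<close>, so the rank does not grow. The same argument for the adjoint gives equality.
\<close>

lemma adjoint_finite_rank:
  assumes T: "bounded_finite_rank sU T" and T': "operator sV sV T'"
    and adj: "\<And>u v. a (T u) v = a u (T' v)"
  shows "bounded_finite_rank sV T'" "V.dim (range T') = U.dim (range T)"
proof -
  obtain B :: "'u set" and f y where B: "finite B" "card B = U.dim (range T)"
    and f: "\<And>b. b \<in> B \<Longrightarrow> f b \<in> dual sU" and Tf: "\<And>x. T x = (\<Sum>b\<in>B. sU (f b x) (y b))"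
    using finite_rank_representation[OF U T] by (elim exE conjE) (rule that, auto)
  have "\<forall>b\<in>B. \<exists>v. \<forall>u. f b u = a u v" using dual_eq_form[OF f] by blast
  then obtain w where w: "\<And>b u. b \<in> B \<Longrightarrow> f b u = a u (w b)" by metis
  have "T' v = (\<Sum>b\<in>B. sV (conjg (a (y b) v)) (w b))" for v
    by (rule form_right_inject)
      (simp add: Tf w form_simps conjg_conjg linear_sum[OF bounded_linear.linear, OF bounded_linear_form_left]
        linear_sum[OF bounded_linear.linear, OF bounded_linear_form_right] mult.commute flip: adj)
  then have range_T': "range T' \<subseteq> V.span (w ` B)"
    by (auto intro!: V.span_sum V.span_scale[OF V.span_base])
  then show T'_rank: "bounded_finite_rank sV T'"
    using B(1) by (intro bounded_finite_rankI[OF V T']) auto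
  have 1: "V.dim (range T') \<le> U.dim (range T)"
    using V.dim_le_card[OF range_T'] card_image_le[OF B(1), of w] B by simp
  obtain B' :: "'v set" and g z where B': "finite B'" "card B' = V.dim (range T')"
    and g: "\<And>b. b \<in> B' \<Longrightarrow> g b \<in> dual sV" and T'g: "\<And>x. T' x = (\<Sum>b\<in>B'. sV (g b x) (z b))"
    using finite_rank_representation[OF V T'_rank] by (elim exE conjE) (rule that, auto)
  have "\<forall>b\<in>B'. \<exists>u. \<forall>v. conjg (g b v) = a u v" using dual_eq_conjg_form[OF g] by blast
  then obtain r where r: "\<And>b v. b \<in> B' \<Longrightarrow> conjg (g b v) = a (r b) v" by metis
  have "T u = (\<Sum>b\<in>B'. sU (a u (z b)) (r b))" for u
    by (rule form_left_inject)
      (simp add: adj T'g r form_simps linear_sum[OF bounded_linear.linear, OF bounded_linear_form_left]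
        linear_sum[OF bounded_linear.linear, OF bounded_linear_form_right] mult.commute)
  then have range_T: "range T \<subseteq> U.span (r ` B')"
    by (auto intro!: U.span_sum U.span_scale[OF U.span_base])
  have "U.dim (range T) \<le> V.dim (range T')"
    using U.dim_le_card[OF range_T] card_image_le[OF B'(1), of r] B' by simp
  then show "V.dim (range T') = U.dim (range T)" using 1 by simp
qed

section \<open>Galerkin approximation and projections\<close>

lemma bounded_projections_if_galerkin:
  assumes X: "approximating_sequence sU X" and gal: "galerkin_converges sV a X Y"
  shows "bounded_projection_approximation_property sU"
proof -
  have fin: "fin_dim_subspace sU (X n)" if "n \<ge> 1" for n
    using X that by (simp add: approximating_sequence_def)
  then have sub: "U.subspace (X n)" if "n \<ge> 1" for n
    using that by (fastforce simp: fin_dim_subspace_def)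
  have ex1: "\<exists>!w. is_solution a (a u) (X n) (Y n) w" if "n \<ge> 1" for n u
    using gal that form_right_antidual[of u] by (simp add: galerkin_converges_def)
  obtain g where g: "g > 0" "\<And>n L u w. n \<ge> 1 \<Longrightarrow> L \<in> antidual sV \<Longrightarrow> is_solution a L UNIV UNIV u \<Longrightarrow>
      is_solution a L (X n) (Y n) w \<Longrightarrow> norm (u - w) \<le> g * infdist u (X n)"
    using gal unfolding galerkin_converges_def by blast
  define P where "P n u = (THE w. is_solution a (a u) (X n) (Y n) w)" for n u
  have P: "is_solution a (a u) (X n) (Y n) (P n u)" if "n \<ge> 1" for n u
    unfolding P_def by (rule theI'[OF ex1[OF that]])
  have P_unique: "P n u = w" if "n \<ge> 1" "is_solution a (a u) (X n) (Y n) w" for n u w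
    using ex1[OF that(1)] P[OF that(1)] that(2) by blast
  have P_in: "P n u \<in> X n" and P_eq: "v \<in> Y n \<Longrightarrow> a (P n u) v = a u v" if "n \<ge> 1" for n u v
    using P[OF that, of u] by (auto simp: is_solution_def)
  have err: "norm (u - P n u) \<le> g * infdist u (X n)" if "n \<ge> 1" for n u
    using that by (intro g(2)[OF _ form_right_antidual _ P]) (auto simp: is_solution_def)
  have fixed: "P n w = w" if "n \<ge> 1" "w \<in> X n" for n w
    using that by (intro P_unique) (auto simp: is_solution_def)
  have P_rank: "bounded_finite_rank sU (P n)" if n: "n \<ge> 1" for n
  proof -
    have "operator sU sU (P n)"
    proof (rule operatorI[OF U U, where K="1 + g"])
      show "P n (x + y) = P n x + P n y" for x y
        using n by (intro P_unique) (auto simp: is_solution_def form_simps P_eq P_in U.subspace_add[OF sub])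
      show "P n (sU c x) = sU c (P n x)" for c x
        using n by (intro P_unique) (auto simp: is_solution_def form_simps P_eq P_in U.subspace_scale[OF sub])
      show "norm (P n x) \<le> (1 + g) * norm x" for x
      proof -
        have "infdist x (X n) \<le> dist x 0" by (rule infdist_le[OF U.subspace_0[OF sub[OF n]]])
        then have "norm (x - P n x) \<le> g * norm x"
          using order_trans[OF err[OF n, of x] mult_left_mono[of "infdist x (X n)" "norm x" g]] g(1) by simp
        moreover have "norm (P n x) \<le> norm x + norm (x - P n x)"
          using norm_triangle_ineq4[of x "x - P n x"] by simp
        ultimately show ?thesis by (simp add: distrib_right)
      qed
    qed
    moreover have "range (P n) = X n"
    proof
      show "range (P n) \<subseteq> X n" using P_in[OF n] by blast
      show "X n \<subseteq> range (P n)" using fixed[OF n] by (metis rangeI subsetI)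
    qed
    ultimately show ?thesis using fin[OF n] by (simp add: bounded_finite_rank_def operator_def)
  qed
  have "(\<lambda>n. P n x) \<longlonglongrightarrow> x" for x
  proof -
    have "(\<lambda>n. g * infdist x (X n)) \<longlonglongrightarrow> 0"
      using X by (intro tendsto_mult_right_zero) (simp add: approximating_sequence_def)
    then have "(\<lambda>n. P n x - x) \<longlonglongrightarrow> 0"
      by (rule Lim_null_comparison[rotated])
        (use err in \<open>auto simp: eventually_sequentially norm_minus_commute intro: exI[of _ 1]\<close>)
    then show ?thesis by (simp add: LIM_zero_iff)
  qed
  then have "approximating_projections sU P"
    unfolding approximating_projections_def using P_rank fixed P_in by (auto simp: fun_eq_iff)
  then show ?thesis unfolding bounded_projection_approximation_property_def by blast
qed

text \<open>
  The Galerkin spaces are the ranges of the projections and of their adjoints. The nesting makes the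
  union of the ranges of the adjoints convex. It is dense: a functional that separates \<open>v\<close> from the
  union is the real part of some \<open>a(u,\<cdot>)\<close>, but \<open>a(u, Q\<^sub>n v) = a(P\<^sub>n u, v)\<close> tends to \<open>a(u, v)\<close>.
\<close>

lemma galerkin_if_finite_dimensional_decomposition:
  assumes inf: "\<not> fin_dim_subspace sU UNIV" and "finite_dimensional_decomposition sU"
  shows "\<exists>X Y. approximating_sequence sU X \<and> approximating_sequence sV Y
    \<and> (\<forall>n\<ge>1. 0 \<noteq> U.dim (X n) \<and> U.dim (X n) = V.dim (Y n)) \<and> galerkin_converges sV a X Y"
proof -
  obtain P0 where P0: "approximating_projections sU P0"
    and nested0: "\<And>m n. m \<ge> 1 \<Longrightarrow> m \<le> n \<Longrightarrow> P0 m \<circ> P0 n = P0 m \<and> P0 n \<circ> P0 m = P0 m"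
    using assms(2) unfolding finite_dimensional_decomposition_def by blast
  have "\<exists>x0::'u. x0 \<noteq> 0"
  proof (rule ccontr)
    assume "\<nexists>x0::'u. x0 \<noteq> 0"
    then have "(UNIV :: 'u set) = U.span {}" by auto
    then show False using inf by (auto simp: fin_dim_subspace_def)
  qed
  then obtain x0 :: 'u where x0: "x0 \<noteq> 0" by blast
  have "(\<lambda>n. P0 n x0) \<longlonglongrightarrow> x0" using P0 by (simp add: approximating_projections_def)
  then have "eventually (\<lambda>n. P0 n x0 \<noteq> 0) sequentially" using x0 by (rule tendsto_imp_eventually_ne)
  then obtain N where N: "\<And>n. n \<ge> N \<Longrightarrow> P0 n x0 \<noteq> 0" unfolding eventually_sequentially by blast
  \<comment> \<open>Skipping \<open>N\<close> members makes all ranges nonzero; the extra shift avoids the meaningless index 0.\<close>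
  define P where "P n = P0 (n + Suc N)" for n
  have P_rank: "bounded_finite_rank sU (P n)" for n
    using P0 by (simp add: approximating_projections_def P_def)
  have P_nested: "P m (P n x) = P m x" "P n (P m x) = P m x" if "m \<le> n" for m n x
    using nested0[of "m + Suc N" "n + Suc N"] that by (auto simp: P_def fun_eq_iff)
  have P_lim: "(\<lambda>n. P n x) \<longlonglongrightarrow> x" for x
    unfolding P_def using P0 by (intro LIMSEQ_ignore_initial_segment) (simp add: approximating_projections_def)
  obtain K where K: "0 \<le> K" "\<And>n x. n \<ge> 1 \<Longrightarrow> norm (P0 n x) \<le> K * norm x"
    using approximating_projections_bounded[OF P0] by blast
  have P_op: "operator sU sU (P n)" for n
    using P_rank[of n] by (rule bounded_finite_rankE)
  have "\<exists>T'. operator sV sV T' \<and> (\<forall>u v. a (P n u) v = a u (T' v))" for n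
    by (rule adjoint_exists[OF P_op])
  then obtain Q where Q_op: "\<And>n. operator sV sV (Q n)" and adj: "\<And>n u v. a (P n u) v = a u (Q n v)"
    by metis
  have Q_rank: "bounded_finite_rank sV (Q n)" and dim_eq: "V.dim (range (Q n)) = U.dim (range (P n))" for n
    using adjoint_finite_rank[OF P_rank Q_op adj] by auto
  have Q_nested: "Q n (Q m v) = Q m v" if "m \<le> n" for m n v
    by (rule form_right_inject) (simp add: P_nested(1)[OF that] flip: adj)
  define M where "M = (\<Union>n. range (Q n))"
  have "convex M"
  proof (rule convexI)
    fix x y and s t :: real assume "x \<in> M" "y \<in> M"
    then obtain m n where mn: "x \<in> range (Q m)" "y \<in> range (Q n)" by (auto simp: M_def)
    define k where "k = max m n"
    have "Q k x = x" "Q k y = y" using mn Q_nested[of m k] Q_nested[of n k] by (auto simp: k_def)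
    then have "s *\<^sub>R x + t *\<^sub>R y = Q k (s *\<^sub>R x + t *\<^sub>R y)"
      using linear_simps[OF operatorD(5)[OF Q_op]] by simp
    then show "s *\<^sub>R x + t *\<^sub>R y \<in> M" unfolding M_def by blast
  qed
  have dense: "\<exists>m\<in>M. norm (m - v) < e" if "e > 0" for v e
  proof (rule ccontr)
    assume "\<not> (\<exists>m\<in>M. norm (m - v) < e)"
    then have "\<And>m. m \<in> M \<Longrightarrow> e \<le> norm (m - v)" by (auto simp: not_less)
    moreover have "M \<noteq> {}" by (auto simp: M_def)
    ultimately obtain f where f: "bounded_linear f" "\<And>m. m \<in> M \<Longrightarrow> f v + e \<le> f m"
      using convex_separation[OF \<open>convex M\<close>, of e v] \<open>e > 0\<close> by (meson less_imp_le)
    obtain F where F: "F \<in> dual sV" "\<And>v. re (F v) = f v" using dual_of_real_functional[OF V f(1)] by blast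
    obtain u where u: "\<And>v. conjg (F v) = a u v" using dual_eq_conjg_form[OF F(1)] by blast
    have fa: "f w = re (a u w)" for w by (simp add: re_conjg F(2) flip: u)
    have "(\<lambda>n. re (a (P n u) v)) \<longlonglongrightarrow> re (a u v)"
      by (intro bounded_linear.tendsto[OF bounded_linear_re]
        bounded_linear.tendsto[OF bounded_linear_form_left] P_lim)
    moreover have "f v + e \<le> re (a (P n u) v)" for n
      using f(2)[of "Q n v"] by (auto simp: M_def fa adj)
    ultimately have "f v + e \<le> re (a u v)" by (intro LIMSEQ_le_const) auto
    then show False using \<open>e > 0\<close> by (simp add: fa)
  qed
  define X where "X n = range (P n)" for n
  define Y where "Y n = range (Q n)" for n
  have "approximating_sequence sU X"
    unfolding approximating_sequence_def
  proof (intro conjI allI impI)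
    show "fin_dim_subspace sU (X n)" for n
      using P_rank[of n] by (simp add: X_def bounded_finite_rank_def)
    fix x
    have "(\<lambda>n. dist x (P n x)) \<longlonglongrightarrow> 0" using tendsto_dist[OF tendsto_const[of x] P_lim[of x]] by simp
    then show "(\<lambda>n. infdist x (X n)) \<longlonglongrightarrow> 0"
      by (rule Lim_null_comparison[rotated]) (auto simp: X_def infdist_nonneg intro!: infdist_le always_eventually)
  qed
  moreover have "approximating_sequence sV Y"
    unfolding approximating_sequence_def
  proof (intro conjI allI impI)
    show "fin_dim_subspace sV (Y n)" for n
      using Q_rank[of n] by (simp add: Y_def bounded_finite_rank_def)
    fix v
    show "(\<lambda>n. infdist v (Y n)) \<longlonglongrightarrow> 0"
    proof (rule LIMSEQ_I)
      fix e :: real assume "e > 0"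
      then obtain m where m: "m \<in> M" "norm (m - v) < e" using dense by blast
      from m(1) obtain k where k: "m \<in> range (Q k)" by (auto simp: M_def)
      have "norm (infdist v (Y n) - 0) < e" if "n \<ge> k" for n
      proof -
        have "m = Q n m" using k Q_nested[OF that] by auto
        then have "m \<in> Y n" unfolding Y_def by blast
        then have "infdist v (Y n) \<le> dist v m" by (rule infdist_le)
        then show ?thesis using m(2) by (simp add: dist_norm norm_minus_commute infdist_nonneg)
      qed
      then show "\<exists>N. \<forall>n\<ge>N. norm (infdist v (Y n) - 0) < e" by blast
    qed
  qed
  moreover have "0 \<noteq> U.dim (X n) \<and> U.dim (X n) = V.dim (Y n)" for n
  proof -
    have "U.dim (range (P n)) \<noteq> 0"
    proof
      assume 0: "U.dim (range (P n)) = 0"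
      obtain B where "finite B" "range (P n) = U.span B" "card B = U.dim (range (P n))"
        using fin_dim_subspace_basis[OF U.vector_space_axioms, of "range (P n)"] P_rank[of n]
        by (auto simp: bounded_finite_rank_def)
      then have "range (P n) = {0}" using 0 by simp
      then have "P n x0 = 0" by blast
      then show False using N[of "n + Suc N"] by (simp add: P_def)
    qed
    then show ?thesis by (simp add: X_def Y_def dim_eq)
  qed
  moreover have "galerkin_converges sV a X Y"
  proof -
    have solves: "is_solution a L (X n) (Y n) (P n u)" if "is_solution a L UNIV UNIV u" for L n u
      using that by (auto simp: is_solution_def X_def Y_def adj Q_nested)
    have unique: "w = w'" if "is_solution a L (X n) (Y n) w" "is_solution a L (X n) (Y n) w'" for L n w w'
    proof (rule form_left_inject)
      fix v
      have "P n w = w" "P n w' = w'" using that by (auto simp: is_solution_def X_def P_nested)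
      then have "a w v = a w (Q n v)" "a w' v = a w' (Q n v)" by (metis adj)+
      then show "a w v = a w' v" using that by (simp add: is_solution_def Y_def)
    qed
    have ex1: "\<exists>!u. is_solution a L UNIV UNIV u" if "L \<in> antidual sV" for L
      using well_posed that by (simp add: is_solution_def)
    have err: "norm (u - P n u) \<le> (1 + K) * infdist u (X n)" for n u
    proof -
      have "norm (u - P n u) / (1 + K) \<le> dist u x" if x: "x \<in> X n" for x
      proof -
        have "P n x = x" using x by (auto simp: X_def P_nested)
        then have "u - P n u = (u - x) - P n (u - x)" by (simp add: operatorD(2)[OF P_op])
        then have "norm (u - P n u) \<le> norm (u - x) + norm (P n (u - x))" by (metis norm_triangle_ineq4)
        also have "\<dots> \<le> norm (u - x) + K * norm (u - x)" using K(2) by (simp add: P_def)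
        finally show ?thesis using K(1) by (simp add: dist_norm field_simps)
      qed
      moreover have "X n \<noteq> {}" by (simp add: X_def)
      ultimately have "norm (u - P n u) / (1 + K) \<le> infdist u (X n)"
        unfolding infdist_def by (auto intro!: cINF_greatest)
      then show ?thesis using K(1) by (simp add: field_simps)
    qed
    show ?thesis
      unfolding galerkin_converges_def
    proof (intro conjI allI ballI impI)
      show "\<exists>!u. is_solution a L UNIV UNIV u" if "L \<in> antidual sV" for L by (rule ex1[OF that])
      show "\<exists>!w. is_solution a L (X n) (Y n) w" if "L \<in> antidual sV" for L n
        using ex1[OF that] solves[of L _ n] unique[of L n] by blast
      show "\<exists>\<gamma>>0. \<forall>n\<ge>1. \<forall>L\<in>antidual sV. \<forall>u w. is_solution a L UNIV UNIV u \<longrightarrow>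
        is_solution a L (X n) (Y n) w \<longrightarrow> norm (u - w) \<le> \<gamma> * infdist u (X n)"
      proof (intro exI[of _ "1 + K"] conjI allI ballI impI)
        show "0 < 1 + K" using K(1) by simp
        fix n L u w assume "is_solution a L UNIV UNIV u" "is_solution a L (X n) (Y n) w"
        then have "w = P n u" using solves unique by blast
        then show "norm (u - w) \<le> (1 + K) * infdist u (X n)" using err by simp
      qed
    qed
  qed
  ultimately show ?thesis by blast
qed

end

theorem theorem3p2:
  fixes sU :: "'k::real_or_complex \<Rightarrow> 'u::banach \<Rightarrow> 'u"
    and sV :: "'k \<Rightarrow> 'v::banach \<Rightarrow> 'v"
    and a :: "'u \<Rightarrow> 'v \<Rightarrow> 'k"
  assumes "banach_over sU" and "banach_over sV"
    and "\<not> fin_dim_subspace sU UNIV" and "\<not> fin_dim_subspace sV UNIV"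
    and "separable_space (euclidean :: 'u topology)"
    and "separable_space (euclidean :: 'v topology)"
    and "reflexive_space sU" and "reflexive_space sV"
    and "sesquilinear sU sV a" and "continuous_form a"
    and "\<forall>L\<in>antidual sV. \<exists>!u. \<forall>v. a u v = L v"
  shows "((\<exists>U V. approximating_sequence sU U \<and> approximating_sequence sV V
          \<and> (\<forall>n\<ge>1. 0 \<noteq> vector_space.dim sU (U n)
                 \<and> vector_space.dim sU (U n) = vector_space.dim sV (V n))
          \<and> galerkin_converges sV a U V) \<longleftrightarrow> bounded_projection_approximation_property sU)
       \<and> (bounded_projection_approximation_property sU \<longleftrightarrow> finite_dimensional_decomposition sU)"
proof -
  interpret well_posed_form sU sV a
    using assms by (intro well_posed_form.intro)
  have fdd: "finite_dimensional_decomposition sU" if "bounded_projection_approximation_property sU"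
    using finite_dimensional_decomposition_if_reflexive[OF assms(1,7,5) that] .
  have bpap: "bounded_projection_approximation_property sU" if "finite_dimensional_decomposition sU"
    using that unfolding finite_dimensional_decomposition_def bounded_projection_approximation_property_def
    by blast
  show ?thesis
    using bounded_projections_if_galerkin
      galerkin_if_finite_dimensional_decomposition[OF assms(3)] fdd bpap by blast
qed

end
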